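(* Let $\zeta=(P,B,\Delta_P)$ be a quantum principal $\mathcal G$-bundle, and complete $B$ into a $C^\ast$-algebra. Then the pair $(E^V_{\mathrm L},\langle-,-\rangle_{\mathrm L})$, consisting of the associated left quantum vector bundle $E^V_{\mathrm L}=\mathrm{Mor}(\delta^V,\Delta_P)$ and its canonical Hermitian structure, is a left Hilbert $C^\ast$-module for every finite-dimensional $\mathcal G$-corepresentation $\delta^V$.
   Context: All algebras are associative unital $\ast$-algebras over $\mathbb C$. $\mathcal G$ is a compact matrix quantum group (Woronowicz) with dense $\ast$-Hopf algebra $(H,\Delta,\epsilon,S,\ast)$. A corepresentation is a linear map $\delta^V:V\to V\otimes H$ with $(\mathrm{id}\otimes\epsilon)\delta^V=\mathrm{id}$, $(\mathrm{id}\otimes\Delta)\delta^V=(\delta^V\otimes\mathrm{id})\delta^V$; $\mathrm{Mor}(\delta^V,\delta^W)$ is the set of linear $T:V\to W$ with $(T\otimes \mathrm{id})\delta^V=\delta^W T$. Every finite-dimensional corepresentation is assumed unitary, i.e. $V$ is equipped with an inner product making $\delta^V$ unitary. A quantum principal $\mathcal G$-bundle $\zeta=(P,B,\Delta_P)$ consists of a $\ast$-algebra $P$, a $\ast$-subalgebra $B$, and a $\ast$-algebra morphism $\Delta_P:P\to P\otimes H$ that is a corepresentation, such that $\Delta_P(x)=x\otimes 1$ iff $x\in B$, and $x\otimes y\mapsto (x\otimes 1)\Delta_P(y)$ maps $P\otimes P$ onto $P\otimes H$. Standing assumption: $B$ can be completed to a $C^\ast$-algebra. In this case, for every irreducible finite-dimensional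 $\delta^V$ with orthonormal basis $\{e_i\}_{i=1}^{n_V}$ of $V$ there are $T^{\mathrm L}_1,\dots,T^{\mathrm L}_{d_V}\in\mathrm{Mor}(\delta^V,\Delta_P)$ with $\sum_k T^{\mathrm L}_k(e_i)^\ast T^{\mathrm L}_k(e_j)=\delta_{ij}1$. $E^V_{\mathrm L}$ denotes $\mathrm{Mor}(\delta^V,\Delta_P)$ with the left $B$-module structure $(bT)(v)=b\,T(v)$; it is a finitely generated projective left $B$-module. Its canonical Hermitian structure is $\langle T_1,T_2\rangle_{\mathrm L}=\sum_{k=1}^{n_V}T_1(e_k)T_2(e_k)^\ast\in B$, where $\{e_k\}_{k=1}^{n_V}$ is any orthonormal basis of $V$. *)

theory Defs
  imports "HOL-Analysis.Analysis" "HOL-Library.Function_Algebras"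
begin

section \<open>Complex vector spaces and *-algebras\<close>

class scaleC =
  fixes scaleC :: "complex \<Rightarrow> 'a \<Rightarrow> 'a"  (infixr "*\<^sub>C" 75)

class complex_vector = scaleC + ab_group_add +
  assumes scaleC_add_right: "a *\<^sub>C (x + y) = a *\<^sub>C x + a *\<^sub>C y"
    and scaleC_add_left: "(a + b) *\<^sub>C x = a *\<^sub>C x + b *\<^sub>C x"
    and scaleC_scaleC: "a *\<^sub>C b *\<^sub>C x = (a * b) *\<^sub>C x"
    and scaleC_one: "1 *\<^sub>C x = x"

global_interpretation complex_vector: vector_space "scaleC :: complex \<Rightarrow> 'a \<Rightarrow> 'a::complex_vector"
  by unfold_locales (simp_all add: scaleC_add_right scaleC_add_left scaleC_scaleC scaleC_one)

global_interpretation complex_vector: vector_space_pair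
  "scaleC :: complex \<Rightarrow> 'a \<Rightarrow> 'a::complex_vector" "scaleC :: complex \<Rightarrow> 'b \<Rightarrow> 'b::complex_vector"
  by unfold_locales

abbreviation complex_linear :: "('a::complex_vector \<Rightarrow> 'b::complex_vector) \<Rightarrow> bool"
  where "complex_linear \<equiv> Vector_Spaces.linear scaleC scaleC"

abbreviation csubspace :: "'a::complex_vector set \<Rightarrow> bool"
  where "csubspace \<equiv> complex_vector.subspace"

abbreviation cspan :: "'a::complex_vector set \<Rightarrow> 'a set"
  where "cspan \<equiv> complex_vector.span"

lemma complex_linear_iff:
  "complex_linear f \<longleftrightarrow> (\<forall>x y. f (x + y) = f x + f y) \<and> (\<forall>c x. f (c *\<^sub>C x) = c *\<^sub>C f x)"
  unfolding Vector_Spaces.linear_iff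
  by (auto intro: complex_vector.vector_space_axioms)

lemma complex_linearI:
  "(\<And>x y. f (x + y) = f x + f y) \<Longrightarrow> (\<And>c x. f (c *\<^sub>C x) = c *\<^sub>C f x) \<Longrightarrow> complex_linear f"
  by (simp add: complex_linear_iff)

lemma complex_linearD:
  assumes "complex_linear f"
  shows "f (x + y) = f x + f y" "f (c *\<^sub>C x) = c *\<^sub>C f x"
  using assms by (simp_all add: complex_linear_iff)

instantiation "fun" :: (type, complex_vector) complex_vector
begin

definition "c *\<^sub>C f = (\<lambda>x. c *\<^sub>C f x)"

instance
  by standard
    (simp_all add: scaleC_fun_def fun_eq_iff scaleC_add_right scaleC_add_left scaleC_scaleC scaleC_one)

end

lemma scaleC_fun_apply [simp]: "(c *\<^sub>C f) x = c *\<^sub>C f x"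
  by (simp add: scaleC_fun_def)

text \<open>Unital *-algebras; unlike in \<^class>\<open>ring_1\<close>, the zero algebra is not excluded.\<close>

class complex_star_algebra = complex_vector + ring + monoid_mult +
  fixes star :: "'a \<Rightarrow> 'a"
  assumes mult_scaleC_left: "(c *\<^sub>C x) * y = c *\<^sub>C (x * y)"
    and mult_scaleC_right: "x * (c *\<^sub>C y) = c *\<^sub>C (x * y)"
    and star_star: "star (star x) = x"
    and star_add: "star (x + y) = star x + star y"
    and star_scaleC: "star (c *\<^sub>C x) = cnj c *\<^sub>C star x"
    and star_mult: "star (x * y) = star y * star x"

instantiation complex :: complex_star_algebra
begin

definition "scaleC (c::complex) (x::complex) = c * x"
definition "star (x::complex) = cnj x"

instance
  by standard (simp_all add: scaleC_complex_def star_complex_def algebra_simps)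

end

definition star_subalgebra :: "'a::complex_star_algebra set \<Rightarrow> bool"
  where "star_subalgebra B \<longleftrightarrow> csubspace B \<and> 1 \<in> B \<and>
    (\<forall>x\<in>B. \<forall>y\<in>B. x * y \<in> B) \<and> (\<forall>x\<in>B. star x \<in> B)"

definition star_hom_on ::
    "'a::complex_star_algebra set \<Rightarrow> ('a \<Rightarrow> 'b::complex_star_algebra) \<Rightarrow> bool"
  where "star_hom_on B f \<longleftrightarrow>
    (\<forall>x\<in>B. \<forall>y\<in>B. f (x + y) = f x + f y) \<and> (\<forall>c. \<forall>x\<in>B. f (c *\<^sub>C x) = c *\<^sub>C f x) \<and>
    f 1 = 1 \<and> (\<forall>x\<in>B. \<forall>y\<in>B. f (x * y) = f x * f y) \<and> (\<forall>x\<in>B. f (star x) = star (f x))"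

abbreviation star_hom :: "('a::complex_star_algebra \<Rightarrow> 'b::complex_star_algebra) \<Rightarrow> bool"
  where "star_hom \<equiv> star_hom_on UNIV"

class cstar_algebra = complex_star_algebra + real_normed_algebra + complete_space +
  assumes scaleR_scaleC: "r *\<^sub>R x = complex_of_real r *\<^sub>C x"
    and norm_scaleC: "norm (c *\<^sub>C x) = cmod c * norm x"
    and cstar_identity: "norm (star x * x) = (norm x)\<^sup>2"

definition cstar_positive :: "'a::cstar_algebra \<Rightarrow> bool"
  where "cstar_positive x \<longleftrightarrow> (\<exists>y. x = star y * y)"


section \<open>Algebraic tensor products\<close>

definition cbilinear ::
    "('a::complex_vector \<Rightarrow> 'b::complex_vector \<Rightarrow> 'c::complex_vector) \<Rightarrow> bool"
  where "cbilinear \<beta> \<longleftrightarrow> (\<forall>x. complex_linear (\<beta> x)) \<and> (\<forall>y. complex_linear (\<lambda>x. \<beta> x y))"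

lemma cbilinear_iff:
  "cbilinear \<beta> \<longleftrightarrow>
    (\<forall>x y z. \<beta> (x + y) z = \<beta> x z + \<beta> y z) \<and> (\<forall>x y z. \<beta> x (y + z) = \<beta> x y + \<beta> x z) \<and>
    (\<forall>c x y. \<beta> (c *\<^sub>C x) y = c *\<^sub>C \<beta> x y) \<and> (\<forall>c x y. \<beta> x (c *\<^sub>C y) = c *\<^sub>C \<beta> x y)"
  unfolding cbilinear_def complex_linear_iff by blast

lemma cbilinearD:
  assumes "cbilinear \<beta>"
  shows "\<beta> (x + y) z = \<beta> x z + \<beta> y z" "\<beta> x (z + w) = \<beta> x z + \<beta> x w"
    "\<beta> (c *\<^sub>C x) z = c *\<^sub>C \<beta> x z" "\<beta> x (c *\<^sub>C z) = c *\<^sub>C \<beta> x z"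
  using assms unfolding cbilinear_iff by blast+

text \<open>The tensor \<open>x \<otimes> y\<close> is represented by the evaluation \<open>\<beta> \<mapsto> \<beta> x y\<close> of bilinear forms,
  and the tensor product by the linear span of these evaluations. That this is the algebraic
  tensor product is the universal property \<open>tensor_universal\<close> below.\<close>

definition tensor_eval ::
    "'a::complex_vector \<Rightarrow> 'b::complex_vector \<Rightarrow> ('a \<Rightarrow> 'b \<Rightarrow> complex) \<Rightarrow> complex"
  where "tensor_eval x y = (\<lambda>\<beta>. if cbilinear \<beta> then \<beta> x y else 0)"

typedef (overloaded) ('a::complex_vector, 'b::complex_vector) tensor =
  "cspan (range (\<lambda>(x :: 'a, y :: 'b). tensor_eval x y))"
  using complex_vector.span_zero by blast

setup_lifting type_definition_tensor

lift_definition tensor :: "'a::complex_vector \<Rightarrow> 'b::complex_vector \<Rightarrow> ('a, 'b) tensor"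
  (infixl "\<otimes>" 80)
  is tensor_eval
  by (rule complex_vector.span_base) auto

instantiation tensor :: (complex_vector, complex_vector) complex_vector
begin

lift_definition zero_tensor :: "('a, 'b) tensor" is 0
  by (rule complex_vector.span_zero)
lift_definition plus_tensor :: "('a, 'b) tensor \<Rightarrow> ('a, 'b) tensor \<Rightarrow> ('a, 'b) tensor" is "(+)"
  by (rule complex_vector.span_add)
lift_definition minus_tensor :: "('a, 'b) tensor \<Rightarrow> ('a, 'b) tensor \<Rightarrow> ('a, 'b) tensor" is "(-)"
  by (rule complex_vector.span_diff)
lift_definition uminus_tensor :: "('a, 'b) tensor \<Rightarrow> ('a, 'b) tensor" is uminus
  by (rule complex_vector.span_neg)
lift_definition scaleC_tensor :: "complex \<Rightarrow> ('a, 'b) tensor \<Rightarrow> ('a, 'b) tensor" is scaleC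
  by (rule complex_vector.span_scale)

instance
  by standard
    (transfer; simp add: scaleC_add_right scaleC_add_left scaleC_scaleC scaleC_one add_ac)+

end

lemma tensor_add_left: "(x + y) \<otimes> z = x \<otimes> z + y \<otimes> z"
  and tensor_add_right: "x \<otimes> (z + w) = x \<otimes> z + x \<otimes> w"
  and tensor_scaleC_left: "(c *\<^sub>C x) \<otimes> z = c *\<^sub>C (x \<otimes> z)"
  and tensor_scaleC_right: "x \<otimes> (c *\<^sub>C z) = c *\<^sub>C (x \<otimes> z)"
  by (transfer; auto simp: tensor_eval_def fun_eq_iff scaleC_complex_def cbilinearD)+

lemma cbilinear_tensor: "cbilinear (\<otimes>)"
  by (simp add: cbilinear_iff tensor_add_left tensor_add_right tensor_scaleC_left tensor_scaleC_right)

lemma tensor_induct [case_names tensor add, induct type: tensor]: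
  assumes "\<And>x y. P (x \<otimes> y)" and "\<And>z w. P z \<Longrightarrow> P w \<Longrightarrow> P (z + w)"
  shows "P z"
proof -
  let ?S = "range (\<lambda>(x :: 'a, y :: 'b). tensor_eval x y)"
  have "\<exists>z. Rep_tensor z = f \<and> P z" if "f \<in> cspan ?S" for f
    using that
  proof (induction rule: complex_vector.span_induct_alt)
    case base
    have "(0::'a) \<otimes> (0::'b) = 0"
      using tensor_scaleC_left[of 0 0 "0::'b"] by simp
    then have "P 0" using assms(1)[of 0 0] by simp
    then show ?case using zero_tensor.rep_eq by blast
  next
    case (step c f g)
    then obtain x y w where "f = tensor_eval x y" "Rep_tensor w = g" "P w" by auto
    then have "Rep_tensor ((c *\<^sub>C x) \<otimes> y + w) = c *\<^sub>C f + g"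
      by (simp add: tensor_scaleC_left plus_tensor.rep_eq scaleC_tensor.rep_eq tensor.rep_eq)
    then show ?case using assms \<open>P w\<close> by blast
  qed
  then obtain z' where "Rep_tensor z' = Rep_tensor z" "P z'"
    using Rep_tensor[of z] by blast
  then show ?thesis by (simp add: Rep_tensor_inject)
qed

lemma tensor_linear_eqI:
  fixes f g :: "('a::complex_vector, 'b::complex_vector) tensor \<Rightarrow> 'c::complex_vector"
  assumes "complex_linear f" "complex_linear g" "\<And>x y. f (x \<otimes> y) = g (x \<otimes> y)"
  shows "f = g"
proof
  show "f z = g z" for z
    by (induction z) (simp_all add: assms(3) complex_linearD(1)[OF assms(1)] complex_linearD(1)[OF assms(2)])
qed

lemma complex_linear_separates:
  fixes w :: "'a::complex_vector"
  assumes "\<And>\<phi> :: 'a \<Rightarrow> complex. complex_linear \<phi> \<Longrightarrow> \<phi> w = \<phi> w'"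
  shows "w = w'"
proof (rule ccontr)
  assume "w \<noteq> w'"
  then have "complex_vector.independent {w - w'}"
    by simp
  then obtain \<phi> :: "'a \<Rightarrow> complex" where "complex_linear \<phi>" "\<phi> (w - w') = 1"
    using complex_vector.linear_independent_extend[of "{w - w'}" "\<lambda>_. 1::complex"] by auto
  moreover have "\<phi> (w - w') = \<phi> w - \<phi> w'"
    using \<open>complex_linear \<phi>\<close> by (rule complex_vector.linear_diff)
  ultimately show False using assms[of \<phi>] by simp
qed

theorem tensor_universal:
  fixes \<beta> :: "'a::complex_vector \<Rightarrow> 'b::complex_vector \<Rightarrow> 'c::complex_vector"
  assumes "cbilinear \<beta>"
  shows "\<exists>!f. complex_linear f \<and> (\<forall>x y. f (x \<otimes> y) = \<beta> x y)"
proof -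
  let ?R = "\<lambda>z w. \<forall>\<phi> :: 'c \<Rightarrow> complex. complex_linear \<phi> \<longrightarrow> \<phi> w = Rep_tensor z (\<lambda>x y. \<phi> (\<beta> x y))"
  have unique: "w = w'" if "?R z w" "?R z w'" for z w w'
    by (rule complex_linear_separates) (use that in auto)
  have bil: "cbilinear (\<lambda>x y. \<phi> (\<beta> x y))" if "complex_linear \<phi>" for \<phi> :: "'c \<Rightarrow> complex"
    using that assms by (simp add: cbilinear_iff complex_linear_iff)
  have base: "?R (x \<otimes> y) (\<beta> x y)" for x y
    by (simp add: tensor.rep_eq tensor_eval_def bil)
  have R_add: "?R (z + z') (w + w')" if "?R z w" "?R z' w'" for z z' w w'
    using that by (simp add: complex_linearD plus_tensor.rep_eq)
  have scale: "?R (c *\<^sub>C z) (c *\<^sub>C w)" if "?R z w" for c z w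
    using that by (simp add: complex_linearD scaleC_tensor.rep_eq)
  have "\<exists>w. ?R z w" for z
  proof (induction z)
    case (tensor x y)
    then show ?case using base by blast
  next
    case (add z w)
    then show ?case using R_add by blast
  qed
  then obtain f where f: "\<And>z. ?R z (f z)" by metis
  have "f (z + w) = f z + f w" for z w
    using f R_add[OF f f] by (rule unique)
  moreover have "f (c *\<^sub>C z) = c *\<^sub>C f z" for c z
    using f scale[OF f] by (rule unique)
  ultimately have "complex_linear f"
    by (rule complex_linearI)
  moreover have "f (x \<otimes> y) = \<beta> x y" for x y
    by (rule unique[OF f base])
  moreover have "g = f" if "complex_linear g \<and> (\<forall>x y. g (x \<otimes> y) = \<beta> x y)" for g
    by (rule tensor_linear_eqI) (use that calculation in simp_all)
  ultimately show ?thesis by blast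
qed

definition tensor_lift ::
    "('a::complex_vector \<Rightarrow> 'b::complex_vector \<Rightarrow> 'c::complex_vector) \<Rightarrow> ('a, 'b) tensor \<Rightarrow> 'c"
  where "tensor_lift \<beta> = (THE f. complex_linear f \<and> (\<forall>x y. f (x \<otimes> y) = \<beta> x y))"

lemma tensor_lift:
  assumes "cbilinear \<beta>"
  shows "complex_linear (tensor_lift \<beta>)" "tensor_lift \<beta> (x \<otimes> y) = \<beta> x y"
  using theI'[OF tensor_universal[OF assms]] by (auto simp: tensor_lift_def)

definition tensor_map ::
    "('a::complex_vector \<Rightarrow> 'c::complex_vector) \<Rightarrow> ('b::complex_vector \<Rightarrow> 'd::complex_vector) \<Rightarrow>
      ('a, 'b) tensor \<Rightarrow> ('c, 'd) tensor"
  where "tensor_map f g = tensor_lift (\<lambda>x y. f x \<otimes> g y)"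

definition tensor_assoc ::
    "(('a::complex_vector, 'b::complex_vector) tensor, 'c::complex_vector) tensor \<Rightarrow>
      ('a, ('b, 'c) tensor) tensor"
  where "tensor_assoc = tensor_lift (\<lambda>t z. tensor_lift (\<lambda>x y. x \<otimes> (y \<otimes> z)) t)"

instantiation tensor :: (complex_star_algebra, complex_star_algebra) complex_star_algebra
begin

definition one_tensor :: "('a, 'b) tensor"
  where "one_tensor = 1 \<otimes> 1"

definition times_tensor :: "('a, 'b) tensor \<Rightarrow> ('a, 'b) tensor \<Rightarrow> ('a, 'b) tensor"
  where "s * t = tensor_lift (\<lambda>x y. tensor_lift (\<lambda>x' y'. (x * x') \<otimes> (y * y')) t) s"

lemma tensor_mult_bilinear: "cbilinear (\<lambda>x' y'. (x * x') \<otimes> (y * y'))" for x :: 'a and y :: 'b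
  by (simp add: cbilinear_iff tensor_add_left tensor_add_right tensor_scaleC_left
      tensor_scaleC_right distrib_left mult_scaleC_right)

lemma tensor_mult_left:
  fixes x :: 'a and y :: 'b
  shows "(x \<otimes> y) * t = tensor_lift (\<lambda>x' y'. (x * x') \<otimes> (y * y')) t"
    and "(x \<otimes> y) * (x' \<otimes> y') = (x * x') \<otimes> (y * y')"
    and "(s + s') * t = s * t + s' * t"
    and "(c *\<^sub>C s) * t = c *\<^sub>C (s * t)"
proof -
  define M where "M = (\<lambda>(x :: 'a) (y :: 'b). tensor_lift (\<lambda>x' y'. (x * x') \<otimes> (y * y')))"
  have lin': "complex_linear (M x y)" and app': "M x y (x' \<otimes> y') = (x * x') \<otimes> (y * y')"
    for x x' :: 'a and y y' :: 'b
    unfolding M_def using tensor_lift[OF tensor_mult_bilinear] by auto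
  have m1: "M (x + w) y t = M x y t + M w y t" for x w :: 'a and y :: 'b and t
    by (induction t)
      (simp_all add: app' complex_linearD(1)[OF lin'] tensor_add_left distrib_right add_ac)
  have m2: "M x (y + z) t = M x y t + M x z t" for x :: 'a and y z :: 'b and t
    by (induction t)
      (simp_all add: app' complex_linearD(1)[OF lin'] tensor_add_right distrib_right add_ac)
  have m3: "M (c *\<^sub>C x) y t = c *\<^sub>C M x y t" for x :: 'a and y :: 'b and t c
    by (induction t)
      (simp_all add: app' complex_linearD(1)[OF lin'] tensor_scaleC_left mult_scaleC_left scaleC_add_right)
  have m4: "M x (c *\<^sub>C y) t = c *\<^sub>C M x y t" for x :: 'a and y :: 'b and t c
    by (induction t)
      (simp_all add: app' complex_linearD(1)[OF lin'] tensor_scaleC_right mult_scaleC_left scaleC_add_right)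
  have bil: "cbilinear (\<lambda>x y. M x y t)" for t :: "('a, 'b) tensor"
    unfolding cbilinear_iff using m1 m2 m3 m4 by blast
  note lin = tensor_lift(1)[OF bil] and app = tensor_lift(2)[OF bil]
  have times: "s * t = tensor_lift (\<lambda>x y. M x y t) s" for s t :: "('a, 'b) tensor"
    by (simp add: times_tensor_def M_def)
  show "(x \<otimes> y) * t = tensor_lift (\<lambda>x' y'. (x * x') \<otimes> (y * y')) t"
    unfolding times app by (simp add: M_def)
  show "(x \<otimes> y) * (x' \<otimes> y') = (x * x') \<otimes> (y * y')"
    unfolding times app by (rule app')
  show "(s + s') * t = s * t + s' * t" "(c *\<^sub>C s) * t = c *\<^sub>C (s * t)"
    unfolding times by (rule complex_linearD[OF lin])+
qed

lemmas tensor_mult = tensor_mult_left(2)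

text \<open>The antilinear map with \<open>star (x \<otimes> y) = star x \<otimes> star y\<close>, see \<open>star_tensor\<close> below.\<close>

lift_definition star_tensor :: "('a, 'b) tensor \<Rightarrow> ('a, 'b) tensor"
  is "\<lambda>f \<beta>. if cbilinear \<beta> then cnj (f (\<lambda>x y. cnj (\<beta> (star x) (star y)))) else 0"
proof -
  let ?S = "range (\<lambda>(x :: 'a, y :: 'b). tensor_eval x y)"
  let ?s = "\<lambda>f (\<beta> :: 'a \<Rightarrow> 'b \<Rightarrow> complex). if cbilinear \<beta> then cnj (f (\<lambda>x y. cnj (\<beta> (star x) (star y)))) else 0"
  fix f assume "f \<in> cspan ?S"
  then show "?s f \<in> cspan ?S"
  proof (induction rule: complex_vector.span_induct_alt)
    case base
    have "?s 0 = 0" by (simp add: fun_eq_iff)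
    then show ?case by (simp only: complex_vector.span_zero)
  next
    case (step c g h)
    then obtain x y where g: "g = tensor_eval x y" by auto
    have "cbilinear (\<lambda>x y. cnj (\<beta> (star x) (star y)))"
      if "cbilinear \<beta>" for \<beta> :: "'a \<Rightarrow> 'b \<Rightarrow> complex"
      using that by (simp add: cbilinear_iff star_add star_scaleC scaleC_complex_def)
    then have "?s (c *\<^sub>C g + h) = cnj c *\<^sub>C tensor_eval (star x) (star y) + ?s h"
      by (auto simp: fun_eq_iff g tensor_eval_def scaleC_complex_def)
    moreover have "tensor_eval (star x) (star y) \<in> cspan ?S"
      by (rule complex_vector.span_base) auto
    ultimately show ?case
      using step(2) by (simp only:) (intro complex_vector.span_add complex_vector.span_scale)
  qed
qed

lemma star_tensor: "star (x \<otimes> y) = star x \<otimes> star y"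
  for x :: 'a and y :: 'b
proof (transfer, rule ext)
  fix x :: 'a and y :: 'b and \<beta> :: "'a \<Rightarrow> 'b \<Rightarrow> complex"
  have "cbilinear \<beta> \<Longrightarrow> cbilinear (\<lambda>x y. cnj (\<beta> (star x) (star y)))"
    by (simp add: cbilinear_iff star_add star_scaleC scaleC_complex_def)
  then show "(if cbilinear \<beta> then cnj (tensor_eval x y (\<lambda>x y. cnj (\<beta> (star x) (star y)))) else 0)
      = tensor_eval (star x) (star y) \<beta>"
    by (simp add: tensor_eval_def)
qed

instance
proof
  fix s t u :: "('a, 'b) tensor" and c :: complex
  note addl = tensor_mult_left(3)
  have lin: "complex_linear (\<lambda>t. (x \<otimes> y) * t)" for x :: 'a and y :: 'b
    unfolding tensor_mult_left(1) by (rule tensor_lift(1)[OF tensor_mult_bilinear])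
  have addr: "s * (t + u) = s * t + s * u" for s t u :: "('a, 'b) tensor"
    by (induction s) (simp_all add: addl complex_linearD(1)[OF lin] add_ac)
  have scr: "s * (c *\<^sub>C t) = c *\<^sub>C (s * t)" for s t :: "('a, 'b) tensor" and c
    by (induction s) (simp_all add: addl complex_linearD(2)[OF lin] scaleC_add_right)
  show "(s + t) * u = s * u + t * u" "s * (t + u) = s * t + s * u"
    by (rule addl addr)+
  show "(c *\<^sub>C s) * t = c *\<^sub>C (s * t)" "s * (c *\<^sub>C t) = c *\<^sub>C (s * t)"
    by (rule tensor_mult_left(4) scr)+
  have assoc1: "(x \<otimes> y) * (x' \<otimes> y') * u = (x \<otimes> y) * ((x' \<otimes> y') * u)"
    for x x' :: 'a and y y' :: 'b
    by (induction u) (simp_all add: addr tensor_mult mult.assoc)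
  have assoc2: "(x \<otimes> y) * t * u = (x \<otimes> y) * (t * u)" for x :: 'a and y :: 'b
    by (induction t) (simp_all add: addl addr assoc1)
  show "s * t * u = s * (t * u)"
    by (induction s) (simp_all add: addl assoc2)
  show "1 * s = s" "s * 1 = s"
    by (induction s; simp add: one_tensor_def addl addr tensor_mult)+
  have star_a: "star (s + t) = star s + star t" for s t :: "('a, 'b) tensor"
    by transfer (auto simp: fun_eq_iff)
  show "star (s + t) = star s + star t" by (rule star_a)
  show "star (c *\<^sub>C s) = cnj c *\<^sub>C star s"
    by transfer (auto simp: fun_eq_iff scaleC_complex_def)
  show "star (star s) = s"
    by (induction s) (simp_all add: star_tensor star_a star_star)
  have "star ((x \<otimes> y) * t) = star t * star (x \<otimes> y)" for x :: 'a and y :: 'b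
    by (induction t) (simp_all add: addl addr star_tensor star_a tensor_mult star_mult)
  then show "star (s * t) = star t * star s"
    by (induction s) (simp_all add: addl addr star_a)
qed

end

text \<open>\<open>V \<otimes> H\<close> inside \<open>'v \<otimes> 'h\<close>, for a subspace \<open>V\<close> of \<open>'v\<close>.\<close>

definition tensor_sub :: "'v::complex_vector set \<Rightarrow> ('v, 'h::complex_vector) tensor set"
  where "tensor_sub V = cspan {v \<otimes> h | v h. v \<in> V}"


section \<open>Compact matrix quantum groups\<close>

locale star_hopf_algebra =
  fixes \<Delta> :: "'h::complex_star_algebra \<Rightarrow> ('h, 'h) tensor"
    and \<epsilon> :: "'h \<Rightarrow> complex"
    and S :: "'h \<Rightarrow> 'h"
  assumes comult_star_hom: "star_hom \<Delta>"
    and counit_star_hom: "star_hom \<epsilon>"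
    and antipode_linear: "complex_linear S"
    and coassoc: "tensor_assoc (tensor_map \<Delta> id (\<Delta> x)) = tensor_map id \<Delta> (\<Delta> x)"
    and counit_left: "tensor_lift (\<lambda>x y. \<epsilon> x *\<^sub>C y) (\<Delta> x) = x"
    and counit_right: "tensor_lift (\<lambda>x y. \<epsilon> y *\<^sub>C x) (\<Delta> x) = x"
    and antipode_left: "tensor_lift (\<lambda>x y. S x * y) (\<Delta> x) = \<epsilon> x *\<^sub>C 1"
    and antipode_right: "tensor_lift (\<lambda>x y. x * S y) (\<Delta> x) = \<epsilon> x *\<^sub>C 1"

definition cstar_state :: "('g::cstar_algebra \<Rightarrow> complex) \<Rightarrow> bool"
  where "cstar_state \<phi> \<longleftrightarrow> complex_linear \<phi> \<and> \<phi> 1 = 1 \<and>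
    (\<forall>x. Im (\<phi> (star x * x)) = 0 \<and> 0 \<le> Re (\<phi> (star x * x)))"

text \<open>\<open>z\<close> has norm at most \<open>r\<close> in the spatial (minimal) C*-tensor product \<open>G \<otimes>\<^sub>m\<^sub>i\<^sub>n G\<close>: the vectors
  \<open>w\<close> of the algebraic tensor product are dense in the tensor product of the GNS spaces of two
  states \<open>\<phi>\<close> and \<open>\<psi>\<close>, and \<open>z\<close> acts on each such space with operator norm at most \<open>r\<close>.\<close>

definition spatial_norm_le :: "('g::cstar_algebra, 'g) tensor \<Rightarrow> real \<Rightarrow> bool"
  where "spatial_norm_le z r \<longleftrightarrow> 0 \<le> r \<and>
    (\<forall>\<phi> \<psi> w. cstar_state \<phi> \<longrightarrow> cstar_state \<psi> \<longrightarrow>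
      Re (tensor_lift (\<lambda>x y. \<phi> x * \<psi> y) (star (z * w) * (z * w)))
        \<le> r\<^sup>2 * Re (tensor_lift (\<lambda>x y. \<phi> x * \<psi> y) (star w * w)))"

text \<open>\<open>\<iota>\<close> embeds the *-Hopf algebra \<open>H\<close> generated by the entries of the \<open>n \<times> n\<close> fundamental
  matrix \<open>u\<close> densely into the C*-algebra \<open>G\<close> of the quantum group. Woronowicz's comultiplication
  \<open>G \<rightarrow> G \<otimes>\<^sub>m\<^sub>i\<^sub>n G\<close> is the continuous extension of \<open>\<Delta>\<close>; it exists iff \<open>\<Delta>\<close> is contractive for the
  two C*-norms.\<close>

locale compact_matrix_quantum_group = star_hopf_algebra \<Delta> \<epsilon> S
  for \<Delta> :: "'h::complex_star_algebra \<Rightarrow> ('h, 'h) tensor"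
    and \<epsilon> :: "'h \<Rightarrow> complex"
    and S :: "'h \<Rightarrow> 'h" +
  fixes \<iota> :: "'h \<Rightarrow> 'g::cstar_algebra"
    and n :: nat
    and u :: "nat \<Rightarrow> nat \<Rightarrow> 'h"
  assumes emb_star_hom: "star_hom \<iota>"
    and emb_inj: "inj \<iota>"
    and emb_dense: "closure (range \<iota>) = UNIV"
    and comult_fundamental: "i < n \<Longrightarrow> j < n \<Longrightarrow> \<Delta> (u i j) = (\<Sum>k<n. u i k \<otimes> u k j)"
    and counit_fundamental: "i < n \<Longrightarrow> j < n \<Longrightarrow> \<epsilon> (u i j) = (if i = j then 1 else 0)"
    and generated: "star_subalgebra A \<Longrightarrow> (\<And>i j. i < n \<Longrightarrow> j < n \<Longrightarrow> u i j \<in> A) \<Longrightarrow> A = UNIV"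
    and comult_extends: "spatial_norm_le (tensor_map \<iota> \<iota> (\<Delta> x)) (norm (\<iota> x))"


section \<open>Corepresentations\<close>

text \<open>Spaces are subspaces \<open>V\<close> of a type; a linear map on \<open>V\<close> into a whole type is given by any
  linear extension to the surrounding type, whose values off \<open>V\<close> play no role.\<close>

definition corepresentation ::
    "('h::complex_star_algebra \<Rightarrow> ('h, 'h) tensor) \<Rightarrow> ('h \<Rightarrow> complex) \<Rightarrow>
      'v::complex_vector set \<Rightarrow> ('v \<Rightarrow> ('v, 'h) tensor) \<Rightarrow> bool"
  where "corepresentation \<Delta> \<epsilon> V \<delta> \<longleftrightarrow>
    csubspace V \<and> complex_linear \<delta> \<and> \<delta> ` V \<subseteq> tensor_sub V \<and>
    (\<forall>v\<in>V. tensor_lift (\<lambda>w h. \<epsilon> h *\<^sub>C w) (\<delta> v) = v) \<and>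
    (\<forall>v\<in>V. tensor_map id \<Delta> (\<delta> v) = tensor_assoc (tensor_map \<delta> id (\<delta> v)))"

text \<open>The morphisms from \<open>V\<close> to \<open>W\<close>. As elements of a function type they are made unique by the
  value \<open>0\<close> off \<open>V\<close>; \<open>T'\<close> is a linear extension, needed to form \<open>T \<otimes> id\<close>.\<close>

definition Mor ::
    "'v::complex_vector set \<Rightarrow> ('v \<Rightarrow> ('v, 'h::complex_vector) tensor) \<Rightarrow>
      'w::complex_vector set \<Rightarrow> ('w \<Rightarrow> ('w, 'h) tensor) \<Rightarrow> ('v \<Rightarrow> 'w) set"
  where "Mor V \<delta>V W \<delta>W = {T. T ` V \<subseteq> W \<and> (\<forall>v. v \<notin> V \<longrightarrow> T v = 0) \<and>
    (\<exists>T'. complex_linear T' \<and> (\<forall>v\<in>V. T' v = T v) \<and>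
      (\<forall>v\<in>V. tensor_map T' id (\<delta>V v) = \<delta>W (T v)))}"

definition inner_product_on :: "'v::complex_vector set \<Rightarrow> ('v \<Rightarrow> 'v \<Rightarrow> complex) \<Rightarrow> bool"
  where "inner_product_on V ip \<longleftrightarrow>
    (\<forall>x\<in>V. \<forall>y\<in>V. \<forall>z\<in>V. ip (x + y) z = ip x z + ip y z) \<and>
    (\<forall>c. \<forall>x\<in>V. \<forall>y\<in>V. ip (c *\<^sub>C x) y = c * ip x y) \<and>
    (\<forall>x\<in>V. \<forall>y\<in>V. ip y x = cnj (ip x y)) \<and>
    (\<forall>x\<in>V. x \<noteq> 0 \<longrightarrow> 0 < Re (ip x x))"

definition orthonormal_basis ::
    "'v::complex_vector set \<Rightarrow> ('v \<Rightarrow> 'v \<Rightarrow> complex) \<Rightarrow> nat \<Rightarrow> (nat \<Rightarrow> 'v) \<Rightarrow> bool"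
  where "orthonormal_basis V ip n e \<longleftrightarrow> cspan (e ` {..<n}) = V \<and>
    (\<forall>i<n. \<forall>j<n. ip (e i) (e j) = (if i = j then 1 else 0))"

definition unitary_corepresentation ::
    "('h::complex_star_algebra \<Rightarrow> ('h, 'h) tensor) \<Rightarrow> ('h \<Rightarrow> complex) \<Rightarrow>
      'v::complex_vector set \<Rightarrow> ('v \<Rightarrow> 'v \<Rightarrow> complex) \<Rightarrow> ('v \<Rightarrow> ('v, 'h) tensor) \<Rightarrow> bool"
  where "unitary_corepresentation \<Delta> \<epsilon> V ip \<delta> \<longleftrightarrow>
    corepresentation \<Delta> \<epsilon> V \<delta> \<and> (\<exists>A. finite A \<and> V = cspan A) \<and> inner_product_on V ip \<and>
    (\<forall>n e. orthonormal_basis V ip n e \<longrightarrow>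
      (\<exists>u. (\<forall>j<n. \<delta> (e j) = (\<Sum>i<n. e i \<otimes> u i j)) \<and>
        (\<forall>i<n. \<forall>j<n. (\<Sum>k<n. star (u k i) * u k j) = (if i = j then 1 else 0)) \<and>
        (\<forall>i<n. \<forall>j<n. (\<Sum>k<n. u i k * star (u j k)) = (if i = j then 1 else 0))))"

definition irreducible_corepresentation ::
    "'v::complex_vector set \<Rightarrow> ('v \<Rightarrow> ('v, 'h::complex_vector) tensor) \<Rightarrow> bool"
  where "irreducible_corepresentation V \<delta> \<longleftrightarrow> V \<noteq> {0} \<and>
    (\<forall>W. csubspace W \<and> W \<subseteq> V \<and> \<delta> ` W \<subseteq> tensor_sub W \<longrightarrow> W = {0} \<or> W = V)"


section \<open>Quantum principal bundles\<close>

locale quantum_principal_bundle =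
  fixes \<Delta> :: "'h::complex_star_algebra \<Rightarrow> ('h, 'h) tensor"
    and \<epsilon> :: "'h \<Rightarrow> complex"
    and \<Delta>P :: "'p::complex_star_algebra \<Rightarrow> ('p, 'h) tensor"
    and B :: "'p set"
  assumes base_star_subalgebra: "star_subalgebra B"
    and coaction_star_hom: "star_hom \<Delta>P"
    and coaction_corepresentation: "corepresentation \<Delta> \<epsilon> UNIV \<Delta>P"
    and base_iff: "\<Delta>P x = x \<otimes> 1 \<longleftrightarrow> x \<in> B"
    and canonical_surj: "surj (tensor_lift (\<lambda>x y. (x \<otimes> 1) * \<Delta>P y))"

definition cstar_completion :: "'p::complex_star_algebra set \<Rightarrow> ('p \<Rightarrow> 'a::cstar_algebra) \<Rightarrow> bool"
  where "cstar_completion B \<iota> \<longleftrightarrow> star_hom_on B \<iota> \<and> inj_on \<iota> B \<and> closure (\<iota> ` B) = UNIV"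

definition associated_left_bundle ::
    "('p::complex_vector \<Rightarrow> ('p, 'h::complex_vector) tensor) \<Rightarrow>
      'v::complex_vector set \<Rightarrow> ('v \<Rightarrow> ('v, 'h) tensor) \<Rightarrow> ('v \<Rightarrow> 'p) set"
  where "associated_left_bundle \<Delta>P V \<delta> = Mor V \<delta> UNIV \<Delta>P"

definition left_action :: "'p::times \<Rightarrow> ('v \<Rightarrow> 'p) \<Rightarrow> 'v \<Rightarrow> 'p"
  where "left_action b T = (\<lambda>v. b * T v)"

definition canonical_hermitian ::
    "nat \<Rightarrow> (nat \<Rightarrow> 'v) \<Rightarrow> ('v \<Rightarrow> 'p::complex_star_algebra) \<Rightarrow> ('v \<Rightarrow> 'p) \<Rightarrow> 'p"
  where "canonical_hermitian n e T\<^sub>1 T\<^sub>2 = (\<Sum>k<n. T\<^sub>1 (e k) * star (T\<^sub>2 (e k)))"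


section \<open>Hilbert C*-modules\<close>

text \<open>Inner product modules over a *-algebra \<open>B\<close> with C*-completion \<open>\<iota> : B \<rightarrow> A\<close>. Positivity is
  positivity in \<open>A\<close>, and the norm of \<open>x\<close> is the square root of \<open>\<parallel>\<iota> \<langle>x, x\<rangle>\<parallel>\<close>. For a C*-algebra
  given by a whole type take \<open>B = UNIV\<close> and \<open>\<iota> = id\<close>.\<close>

definition left_inner_product_module ::
    "'b::complex_star_algebra set \<Rightarrow> ('b \<Rightarrow> 'a::cstar_algebra) \<Rightarrow>
      ('b \<Rightarrow> 'e::complex_vector \<Rightarrow> 'e) \<Rightarrow> 'e set \<Rightarrow> ('e \<Rightarrow> 'e \<Rightarrow> 'b) \<Rightarrow> bool"
  where "left_inner_product_module B \<iota> act E ip \<longleftrightarrow>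
    csubspace E \<and>
    (\<forall>a\<in>B. \<forall>x\<in>E. act a x \<in> E) \<and>
    (\<forall>a\<in>B. \<forall>x\<in>E. \<forall>y\<in>E. act a (x + y) = act a x + act a y) \<and>
    (\<forall>a\<in>B. \<forall>b\<in>B. \<forall>x\<in>E. act (a + b) x = act a x + act b x) \<and>
    (\<forall>a\<in>B. \<forall>b\<in>B. \<forall>x\<in>E. act (a * b) x = act a (act b x)) \<and>
    (\<forall>c. \<forall>x\<in>E. act (c *\<^sub>C 1) x = c *\<^sub>C x) \<and>
    (\<forall>x\<in>E. \<forall>y\<in>E. ip x y \<in> B) \<and>
    (\<forall>x\<in>E. \<forall>y\<in>E. \<forall>z\<in>E. ip (x + y) z = ip x z + ip y z) \<and>
    (\<forall>a\<in>B. \<forall>x\<in>E. \<forall>y\<in>E. ip (act a x) y = a * ip x y) \<and>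
    (\<forall>x\<in>E. \<forall>y\<in>E. ip y x = star (ip x y)) \<and>
    (\<forall>x\<in>E. cstar_positive (\<iota> (ip x x))) \<and>
    (\<forall>x\<in>E. ip x x = 0 \<longrightarrow> x = 0)"

definition module_norm :: "('b \<Rightarrow> 'a::cstar_algebra) \<Rightarrow> ('e \<Rightarrow> 'e \<Rightarrow> 'b) \<Rightarrow> 'e \<Rightarrow> real"
  where "module_norm \<iota> ip x = sqrt (norm (\<iota> (ip x x)))"

text \<open>Here \<open>B\<close> is itself a C*-algebra, through the bijection \<open>\<iota> : B \<rightarrow> A\<close>.\<close>

definition left_hilbert_module ::
    "'b::complex_star_algebra set \<Rightarrow> ('b \<Rightarrow> 'a::cstar_algebra) \<Rightarrow>
      ('b \<Rightarrow> 'e::complex_vector \<Rightarrow> 'e) \<Rightarrow> 'e set \<Rightarrow> ('e \<Rightarrow> 'e \<Rightarrow> 'b) \<Rightarrow> bool"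
  where "left_hilbert_module B \<iota> act E ip \<longleftrightarrow>
    star_subalgebra B \<and> star_hom_on B \<iota> \<and> bij_betw \<iota> B UNIV \<and>
    left_inner_product_module B \<iota> act E ip \<and>
    (\<forall>X :: nat \<Rightarrow> 'e. range X \<subseteq> E \<longrightarrow>
      (\<forall>r>0. \<exists>N. \<forall>m\<ge>N. \<forall>n\<ge>N. module_norm \<iota> ip (X m - X n) < r) \<longrightarrow>
      (\<exists>x\<in>E. (\<lambda>n. module_norm \<iota> ip (X n - x)) \<longlonglongrightarrow> 0))"

text \<open>The Hilbert module \<open>(F, ipF)\<close> over \<open>A\<close> is obtained from \<open>(E, ipE)\<close> by completing the scalars
  from \<open>B\<close> to \<open>A\<close>: \<open>j\<close> is an isometric \<open>B\<close>-linear embedding with dense range, and already the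
  finite \<open>A\<close>-linear combinations of the range exhaust \<open>F\<close>.\<close>

definition completes_module ::
    "'b::complex_star_algebra set \<Rightarrow> ('b \<Rightarrow> 'a::cstar_algebra) \<Rightarrow>
      ('b \<Rightarrow> 'e::complex_vector \<Rightarrow> 'e) \<Rightarrow> 'e set \<Rightarrow> ('e \<Rightarrow> 'e \<Rightarrow> 'b) \<Rightarrow>
      ('a \<Rightarrow> 'f::complex_vector \<Rightarrow> 'f) \<Rightarrow> 'f set \<Rightarrow> ('f \<Rightarrow> 'f \<Rightarrow> 'a) \<Rightarrow> ('e \<Rightarrow> 'f) \<Rightarrow> bool"
  where "completes_module B \<iota> actE E ipE actF F ipF j \<longleftrightarrow>
    j ` E \<subseteq> F \<and>
    (\<forall>x\<in>E. \<forall>y\<in>E. j (x + y) = j x + j y) \<and>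
    (\<forall>b\<in>B. \<forall>x\<in>E. j (actE b x) = actF (\<iota> b) (j x)) \<and>
    (\<forall>x\<in>E. \<forall>y\<in>E. ipF (j x) (j y) = \<iota> (ipE x y)) \<and>
    (\<forall>y\<in>F. \<forall>r>0. \<exists>x\<in>E. module_norm id ipF (y - j x) < r) \<and>
    (\<forall>y\<in>F. \<exists>m a x. (\<forall>k<m. x k \<in> E) \<and> y = (\<Sum>k<(m::nat). actF (a k) (j (x k))))"

end

theory Submission
  imports Defs
begin

text \<open>If \<open>\<Sum>\<^sub>k T\<^sub>k(e\<^sub>i)\<^sup>* T\<^sub>k(e\<^sub>j) = \<delta>\<^sub>i\<^sub>j\<close>, then every \<open>T\<close> equals \<open>\<Sum>\<^sub>k \<langle>T, T\<^sub>k\<rangle> T\<^sub>k\<close> and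
  \<open>\<langle>T, T\<rangle> = \<Sum>\<^sub>k \<langle>T, T\<^sub>k\<rangle> \<langle>T, T\<^sub>k\<rangle>\<^sup>*\<close>. Positivity of the Hermitian structure thus becomes positivity of
  a sum of elements \<open>b b\<^sup>*\<close> of the C*-completion \<open>A\<close> of \<open>B\<close>, and \<open>T \<mapsto> (\<langle>T, T\<^sub>k\<rangle>)\<^sub>k\<close> embeds the bundle
  isometrically into \<open>A\<^sup>d\<close>, with image dense in the range of the projection \<open>(\<langle>T\<^sub>k, T\<^sub>l\<rangle>)\<^sub>k\<^sub>l\<close>; this range
  is a Hilbert module. Such a frame is given for irreducible corepresentations; a unitary
  corepresentation is an orthogonal sum of irreducible ones, and the frames of the summands,
  extended by zero, form a frame of the sum.\<close>

section \<open>Positive elements of C*-algebras\<close>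

text \<open>The class \<open>cstar_algebra\<close> postulates no order, and
  \<open>cstar_positive\<close> merely asserts the form \<open>star y * y\<close>. That sums of such
  elements have this form again is the analytic fact behind both positivity and the domination of
  each coordinate by the module norm. A frame may be linearly dependent, so coordinate vectors fill
  only a part of the free module. Reconstruction of the frame vectors themselves makes the Gram
  matrix Q idempotent, and v Q = v is a closed condition; hence completeness can be checked
  coordinatewise. As B need not be complete, limits are formed over A; they return to the bundle
  when \<iota> is onto. For reducible corepresentations the obstacle is invariance of the orthogonal
  complement. Over a noncommutative algebra a block triangular unitary need not be block diagonal:
  the unitary dilation of a shift is a counterexample. Unitarity alone is therefore not enough, and
  the antipode has to enter.\<close>

instance cstar_algebra \<subseteq> banach ..

lemma star_zero [simp]: "star (0::'a::complex_star_algebra) = 0"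
  using star_add[of "0::'a" 0] by simp

lemma star_one [simp]: "star (1::'a::complex_star_algebra) = 1"
  by (metis mult_1 mult_1_right star_mult star_star)

lemma star_minus: "star (- x) = - star (x::'a::complex_star_algebra)"
  by (metis add_eq_0_iff ab_group_add_class.ab_left_minus star_add star_zero)

lemma star_diff: "star (x - y) = star x - star (y::'a::complex_star_algebra)"
  by (metis diff_conv_add_uminus star_add star_minus)

lemma star_sum: "star (sum f A) = (\<Sum>i\<in>A. star (f i :: 'a::complex_star_algebra))"
  by (induction A rule: infinite_finite_induct) (simp_all add: star_add)

lemma star_scaleR: "star (r *\<^sub>R x) = r *\<^sub>R star (x::'a::cstar_algebra)"
  by (simp add: scaleR_scaleC star_scaleC)

lemma norm_star [simp]: "norm (star x) = norm (x::'a::cstar_algebra)"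
proof -
  have le: "norm x \<le> norm (star x)" for x :: 'a
  proof (cases "x = 0")
    case False
    have "norm x * norm x \<le> norm (star x) * norm x"
      using norm_mult_ineq[of "star x" x] by (simp add: cstar_identity power2_eq_square)
    then show ?thesis using False by simp
  qed simp
  show ?thesis using le[of x] le[of "star x"] by (simp add: star_star)
qed

lemma norm_mult_star: "norm (x * star x) = (norm (x::'a::cstar_algebra))\<^sup>2"
  using cstar_identity[of "star x"] by (simp add: star_star)

lemma norm_square_selfadjoint:
  fixes x :: "'a::cstar_algebra"
  assumes "star x = x"
  shows "norm (x * x) = (norm x)\<^sup>2"
  using cstar_identity[of x] assms by simp

lemma norm_one_le: "norm (1::'a::cstar_algebra) \<le> 1"
proof -
  have "norm (1::'a) * norm (1::'a) = norm (1::'a)"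
    using cstar_identity[of "1::'a"] by (simp add: power2_eq_square)
  then show ?thesis by auto
qed

lemma norm_scaleR_one_le: "0 \<le> t \<Longrightarrow> norm (t *\<^sub>R (1::'a::cstar_algebra)) \<le> t"
  by (simp add: mult_left_le norm_one_le)

lemma tendsto_star:
  fixes f :: "nat \<Rightarrow> 'a::cstar_algebra"
  assumes "f \<longlonglongrightarrow> l"
  shows "(\<lambda>n. star (f n)) \<longlonglongrightarrow> star l"
proof -
  have "(\<lambda>n. norm (star (f n) - star l)) = (\<lambda>n. norm (f n - l))"
    by (simp flip: star_diff)
  then show ?thesis
    using assms by (metis LIM_zero LIM_zero_cancel tendsto_norm_zero tendsto_norm_zero_cancel)
qed

text \<open>The equation \<open>(1 - y)\<^sup>2 = 1 - x\<close> says \<open>y = (x + y\<^sup>2) / 2\<close>. The iteration from \<open>y = 0\<close> converges since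
  its increments are dominated by those of the scalar iteration with \<open>x = 1\<close>.\<close>

lemma sqrt_one_minus:
  fixes x :: "'a::cstar_algebra"
  assumes sa: "star x = x" and nx: "norm x \<le> 1"
  obtains y where "star y = y" "norm y \<le> 1" "(1 - y) * (1 - y) = 1 - x"
    "\<And>z. z * x = x * z \<Longrightarrow> z * y = y * z"
proof -
  define y where "y = rec_nat (0::'a) (\<lambda>_ y. (1/2) *\<^sub>R (x + y * y))"
  define t where "t = rec_nat (0::real) (\<lambda>_ t. (1 + t * t) / 2)"
  have y0: "y 0 = 0" and yS: "y (Suc n) = (1/2) *\<^sub>R (x + y n * y n)" for n
    by (simp_all add: y_def)
  have t0: "t 0 = 0" and tS: "t (Suc n) = (1 + t n * t n) / 2" for n
    by (simp_all add: t_def)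
  have t01: "0 \<le> t n \<and> t n \<le> 1" for n
  proof (induction n)
    case (Suc n)
    then show ?case using mult_le_one[of "t n" "t n"] by (simp add: tS)
  qed (simp add: t0)
  have tinc: "t n \<le> t (Suc n)" for n
    using zero_le_square[of "t n - 1"] by (simp add: tS field_simps)
  have comm: "z * y n = y n * z" if "z * x = x * z" for z n
  proof (induction n)
    case (Suc n)
    have "z * (y n * y n) = (y n * y n) * z"
      using Suc by (metis mult.assoc)
    then show ?case using that by (simp add: yS algebra_simps)
  qed (simp add: y0)
  have commy: "y m * y n = y n * y m" for m n
    by (rule comm) (metis comm)
  have say: "star (y n) = y n" for n
    by (induction n) (simp_all add: y0 yS star_scaleR star_add star_mult sa)
  have ny: "norm (y n) \<le> t n" for n
  proof (induction n)
    case (Suc n)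
    have "norm (x + y n * y n) \<le> 1 + t n * t n"
      using Suc nx norm_triangle_ineq[of x "y n * y n"] norm_mult_ineq[of "y n" "y n"]
        mult_mono[OF Suc Suc] t01[of n] by auto
    then show ?case by (simp add: yS tS)
  qed (simp add: y0 t0)
  have step: "norm (y (Suc n) - y n) \<le> t (Suc n) - t n" for n
  proof (induction n)
    case 0
    then show ?case using nx by (simp add: y0 t0 yS tS)
  next
    case (Suc n)
    \<comment> \<open>The difference of squares factors because the iterates commute. The scalar
      sequence satisfies the same identity, so the induction closes without loss.\<close>
    have "y (Suc (Suc n)) - y (Suc n) = (1/2) *\<^sub>R ((y (Suc n) + y n) * (y (Suc n) - y n))"
    proof -
      have "y (Suc (Suc n)) - y (Suc n) = (1/2) *\<^sub>R (y (Suc n) * y (Suc n) - y n * y n)"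
        by (subst yS[of "Suc n"], subst (3) yS[of n]) (simp flip: scaleR_diff_right)
      then show ?thesis using commy[of "Suc n" n] by (simp add: algebra_simps)
    qed
    also have "norm \<dots> \<le> (1/2) * ((t (Suc n) + t n) * (t (Suc n) - t n))"
    proof -
      have "norm ((y (Suc n) + y n) * (y (Suc n) - y n)) \<le> norm (y (Suc n) + y n) * norm (y (Suc n) - y n)"
        by (rule norm_mult_ineq)
      also have "\<dots> \<le> (t (Suc n) + t n) * (t (Suc n) - t n)"
        using Suc ny[of n] ny[of "Suc n"] norm_triangle_ineq[of "y (Suc n)" "y n"] t01[of n] t01[of "Suc n"]
        by (intro mult_mono) auto
      finally show ?thesis by simp
    qed
    also have "\<dots> = t (Suc (Suc n)) - t (Suc n)"
      by (simp only: tS[of "Suc n"]) (simp add: tS[of n] field_simps)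
    finally show ?case .
  qed
  have "incseq t" by (rule incseq_SucI) (rule tinc)
  then have "convergent t"
    using t01 by (metis incseq_convergent convergentI)
  then have "Cauchy t" by (rule convergent_Cauchy)
  have dist: "norm (y (m + k) - y m) \<le> t (m + k) - t m" for m k
  proof (induction k)
    case (Suc k)
    have "norm (y (m + Suc k) - y m) \<le> norm (y (Suc (m + k)) - y (m + k)) + norm (y (m + k) - y m)"
      using norm_triangle_ineq[of "y (Suc (m + k)) - y (m + k)" "y (m + k) - y m"] by simp
    then show ?case using Suc step[of "m + k"] by simp
  qed simp
  have "Cauchy y"
  proof (rule CauchyI')
    fix e :: real assume "0 < e"
    then obtain M where M: "\<And>m n. m \<ge> M \<Longrightarrow> n \<ge> M \<Longrightarrow> norm (t m - t n) < e"
      using \<open>Cauchy t\<close> unfolding Cauchy_iff by blast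
    show "\<exists>M. \<forall>m\<ge>M. \<forall>n>m. dist (y m) (y n) < e"
    proof (intro exI allI impI)
      fix m n assume "M \<le> m" "m < n"
      then obtain k where "n = m + k" using less_imp_add_positive by blast
      then have "norm (y n - y m) \<le> \<bar>t n - t m\<bar>" using dist[of m k] by simp
      also have "\<dots> < e" using M[of n m] \<open>M \<le> m\<close> \<open>m < n\<close> by simp
      finally show "dist (y m) (y n) < e" by (simp add: dist_norm norm_minus_commute)
    qed
  qed
  then obtain l where l: "y \<longlonglongrightarrow> l"
    using Cauchy_convergent convergent_def by blast
  have "(\<lambda>n. y (Suc n)) \<longlonglongrightarrow> (1/2) *\<^sub>R (x + l * l)"
    unfolding yS by (intro tendsto_intros l)
  then have l_eq: "l = (1/2) *\<^sub>R (x + l * l)"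
    using LIMSEQ_unique LIMSEQ_Suc[OF l] by blast
  show thesis
  proof
    show "star l = l"
      using tendsto_star[OF l] l LIMSEQ_unique by (simp add: say)
    have "norm (y n) \<le> 1" for n using ny[of n] t01[of n] by linarith
    then show "norm l \<le> 1"
      using tendsto_norm[OF l] by (intro LIMSEQ_le_const2) auto
    have "l + l = x + l * l"
      by (subst (1 2) l_eq) (simp flip: scaleR_add_left)
    then show "(1 - l) * (1 - l) = 1 - x"
      by (simp add: algebra_simps)
    fix z assume "z * x = x * z"
    then have "(\<lambda>n. z * y n) = (\<lambda>n. y n * z)" using comm by auto
    moreover have "(\<lambda>n. z * y n) \<longlonglongrightarrow> z * l" "(\<lambda>n. y n * z) \<longlonglongrightarrow> l * z"
      by (intro tendsto_intros l)+
    ultimately show "z * l = l * z" using LIMSEQ_unique by metis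
  qed
qed

text \<open>Positivity is characterised by the norm, without spectral theory: for selfadjoint \<open>h\<close>,
  \<open>\<parallel>t - h\<parallel> \<le> t\<close> holds for some \<open>t \<ge> 0\<close> iff the spectrum of \<open>h\<close> is nonnegative. This makes sums of
  positive elements positive, and \<open>sqrt_one_minus\<close> gives square roots.\<close>

definition cpos :: "'a::cstar_algebra \<Rightarrow> bool"
  where "cpos h \<longleftrightarrow> star h = h \<and> (\<exists>t\<ge>0. norm (t *\<^sub>R 1 - h) \<le> t)"

lemma cpos_selfadjoint: "cpos h \<Longrightarrow> star h = h"
  by (simp add: cpos_def)

section \<open>The positive cone and its square roots\<close>

lemma cpos_zero [simp]: "cpos 0"
  by (auto simp: cpos_def)

text \<open>The witnesses \<open>s\<close> and \<open>t\<close> add up by the triangle inequality;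
  this is the gain from a norm criterion.\<close>

lemma cpos_add:
  assumes "cpos g" "cpos h"
  shows "cpos (g + h)"
proof -
  obtain s t where st: "0 \<le> s" "norm (s *\<^sub>R 1 - g) \<le> s" "0 \<le> t" "norm (t *\<^sub>R 1 - h) \<le> t"
    using assms unfolding cpos_def by blast
  have "norm ((s + t) *\<^sub>R 1 - (g + h)) = norm ((s *\<^sub>R 1 - g) + (t *\<^sub>R 1 - h))"
    by (simp add: algebra_simps)
  also have "\<dots> \<le> s + t" using st norm_triangle_ineq[of "s *\<^sub>R 1 - g" "t *\<^sub>R 1 - h"] by linarith
  finally show ?thesis
    using assms st unfolding cpos_def by (auto simp: star_add intro!: exI[of _ "s + t"])
qed

lemma cpos_sum: "(\<And>i. i \<in> I \<Longrightarrow> cpos (f i)) \<Longrightarrow> cpos (sum f I)"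
  by (induction I rule: infinite_finite_induct) (auto intro: cpos_add)

lemma cpos_scaleR:
  assumes "cpos h" "0 \<le> r"
  shows "cpos (r *\<^sub>R h)"
proof -
  obtain t where t: "0 \<le> t" "norm (t *\<^sub>R 1 - h) \<le> t"
    using assms unfolding cpos_def by blast
  have "norm ((r * t) *\<^sub>R 1 - r *\<^sub>R h) = norm (r *\<^sub>R (t *\<^sub>R 1 - h))"
    by (simp add: algebra_simps)
  also have "\<dots> \<le> r * t"
    using t \<open>0 \<le> r\<close> by (simp add: mult_left_mono)
  finally show ?thesis
    using assms t unfolding cpos_def by (auto simp: star_scaleR intro!: exI[of _ "r * t"])
qed

text \<open>Rescaling gives \<open>h = t (1 - x)\<close> with \<open>norm x \<le> 1\<close>, to
  which \<open>sqrt_one_minus\<close> applies. The commutation clause stands in for functional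
  calculus: it lets roots of commuting elements be combined later.\<close>

lemma cpos_sqrt:
  assumes "cpos h"
  obtains s where "cpos s" "s * s = h" "\<And>z. z * h = h * z \<Longrightarrow> z * s = s * z"
proof -
  obtain t where t: "0 \<le> t" "norm (t *\<^sub>R 1 - h) \<le> t" and sa: "star h = h"
    using assms unfolding cpos_def by blast
  show thesis
  proof (cases "t = 0")
    case True
    then show thesis using t that[of 0] by simp
  next
    case False
    with t have t0: "0 < t" by simp
    define x where "x = 1 - (1/t) *\<^sub>R h"
    have "x = (1/t) *\<^sub>R (t *\<^sub>R 1 - h)" using t0 by (simp add: x_def algebra_simps)
    then have "norm x = (1/t) * norm (t *\<^sub>R 1 - h)" using t0 by (metis abs_of_pos divide_pos_pos norm_scaleR zero_less_one)
    also have "\<dots> \<le> 1" using t0 t by (simp add: field_simps)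
    finally have nx: "norm x \<le> 1" .
    have sax: "star x = x" by (simp add: x_def star_diff star_scaleR sa)
    obtain y where y: "star y = y" "norm y \<le> 1" "(1 - y) * (1 - y) = 1 - x"
        "\<And>z. z * x = x * z \<Longrightarrow> z * y = y * z"
      using sqrt_one_minus[OF sax nx] by blast
    show thesis
    proof (rule that[of "sqrt t *\<^sub>R (1 - y)"])
      \<comment> \<open>The witness for the root is \<open>sqrt t\<close>, since the difference
        equals \<open>sqrt t\<close> times \<open>y\<close>.\<close>
      have "norm (sqrt t *\<^sub>R 1 - sqrt t *\<^sub>R (1 - y)) \<le> sqrt t"
        using t0 y(2) by (simp add: algebra_simps)
      then show "cpos (sqrt t *\<^sub>R (1 - y))"
        using t0 y(1) unfolding cpos_def
        by (auto simp: star_scaleR star_diff intro!: exI[of _ "sqrt t"])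
      show "sqrt t *\<^sub>R (1 - y) * (sqrt t *\<^sub>R (1 - y)) = h"
        using t0 y(3) by (simp add: x_def)
      fix z assume "z * h = h * z"
      then have "z * x = x * z" by (simp add: x_def algebra_simps)
      then show "z * (sqrt t *\<^sub>R (1 - y)) = (sqrt t *\<^sub>R (1 - y)) * z"
        using y(4)[of z] by (simp add: algebra_simps)
    qed
  qed
qed

text \<open>Serves as the implication from \<open>0 \<le> s * s \<le> m\<close> to a norm bound,
  where \<open>r\<close> is a root of \<open>m - s * s\<close> commuting with
  \<open>s\<close>.\<close>

lemma norm_square_le:
  fixes s r :: "'a::cstar_algebra"
  assumes "star s = s" "star r = r" "s * r = r * s" "s * s + r * r = m *\<^sub>R 1" "0 \<le> m"
  shows "norm (s * s) \<le> m"
proof -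
  \<comment> \<open>\<open>u\<close> is \<open>\<surd>m\<close> times a unitary, with real part \<open>s\<close>\<close>
  define u where "u = s + \<i> *\<^sub>C r"
  have su: "star u = s - \<i> *\<^sub>C r"
    by (simp add: u_def star_add star_scaleC assms)
  have "star u * u = m *\<^sub>R 1"
    using assms unfolding su by (simp add: u_def algebra_simps mult_scaleC_left mult_scaleC_right scaleC_scaleC)
  then have "(norm u)\<^sup>2 \<le> m"
    using cstar_identity[of u] norm_scaleR_one_le[OF \<open>0 \<le> m\<close>, where 'a='a] by simp
  have "2 *\<^sub>R s = u + star u" unfolding su by (simp add: u_def scaleR_2)
  then have "2 * norm s \<le> 2 * norm u"
    using norm_triangle_ineq[of u "star u"] by (metis norm_scaleR norm_star abs_numeral mult_2)
  then have "(norm s)\<^sup>2 \<le> (norm u)\<^sup>2" by (simp add: power_mono)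
  then show ?thesis
    using \<open>(norm u)\<^sup>2 \<le> m\<close> norm_square_selfadjoint[OF assms(1)] by linarith
qed

lemma norm_diff_square:
  fixes s :: "'a::cstar_algebra"
  assumes sa: "star s = s"
  shows "norm (norm (s * s) *\<^sub>R 1 - s * s) \<le> norm (s * s)"
proof -
  let ?t = "norm (s * s)"
  \<comment> \<open>With the witness \<open>?t\<close> the required bound is just
    \<open>norm (s * s) \<le> ?t\<close>. The root \<open>r\<close> of this element then trades
    places with \<open>s\<close> in \<open>norm_square_le\<close>.\<close>
  have "cpos (?t *\<^sub>R 1 - s * s)"
    unfolding cpos_def by (auto simp: star_diff star_scaleR star_mult sa intro!: exI[of _ ?t])
  then obtain r where r: "cpos r" "r * r = ?t *\<^sub>R 1 - s * s"
      "\<And>z. z * (?t *\<^sub>R 1 - s * s) = (?t *\<^sub>R 1 - s * s) * z \<Longrightarrow> z * r = r * z"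
    using cpos_sqrt by blast
  have "s * r = r * s" by (rule r(3)) (simp add: algebra_simps)
  then have "norm (r * r) \<le> ?t"
    by (intro norm_square_le[of r s] cpos_selfadjoint r(1) sa norm_ge_zero) (simp_all add: r(2))
  then show ?thesis by (simp add: r(2))
qed

lemma cpos_square: "star s = s \<Longrightarrow> cpos (s * s)"
  unfolding cpos_def by (auto simp: star_mult intro!: exI[of _ "norm (s * s)"] norm_diff_square)

text \<open>The definition supplies only some \<open>t\<close>; writing \<open>h\<close> as a square
  shows that \<open>norm h\<close> itself is always a witness.\<close>

lemma cpos_norm_diff:
  assumes "cpos h"
  shows "norm (norm h *\<^sub>R 1 - h) \<le> norm h" and "cpos (norm h *\<^sub>R 1 - h)"
proof -
  obtain s where "cpos s" "s * s = h" using cpos_sqrt[OF assms] by blast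
  then show "norm (norm h *\<^sub>R 1 - h) \<le> norm h"
    using norm_diff_square[of s] cpos_selfadjoint by blast
  show "cpos (norm h *\<^sub>R 1 - h)"
    using assms unfolding cpos_def
    by (auto simp: star_diff star_scaleR intro!: exI[of _ "norm h"])
qed

text \<open>Adding \<open>b - a\<close> to the positive element \<open>norm b - b\<close> shows that
  \<open>norm b - a\<close> is positive. Its root commutes with the root of \<open>a\<close>, so
  \<open>norm_square_le\<close> applies with \<open>m = norm b\<close>.\<close>

lemma cpos_norm_mono:
  assumes "cpos a" "cpos (b - a)"
  shows "norm a \<le> norm b"
proof -
  have "cpos b" using cpos_add[OF assms] by simp
  have "cpos (norm b *\<^sub>R 1 - a)"
    using cpos_add[OF cpos_norm_diff(2)[OF \<open>cpos b\<close>] assms(2)] by simp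
  then obtain r where r: "cpos r" "r * r = norm b *\<^sub>R 1 - a"
      "\<And>z. z * (norm b *\<^sub>R 1 - a) = (norm b *\<^sub>R 1 - a) * z \<Longrightarrow> z * r = r * z"
    using cpos_sqrt by blast
  obtain s where s: "cpos s" "s * s = a" using cpos_sqrt[OF assms(1)] by blast
  have "s * a = a * s" unfolding s(2)[symmetric] by (simp add: mult.assoc)
  then have "s * r = r * s" by (intro r(3)) (simp add: algebra_simps)
  then have "norm (s * s) \<le> norm b"
    by (intro norm_square_le[of s r] cpos_selfadjoint r(1) s(1)) (simp_all add: r(2) s(2))
  then show ?thesis by (simp only: s(2))
qed

text \<open>With \<open>p = z z\<^sup>*\<close>, \<open>w = M + z\<^sup>* z\<close> and \<open>M = \<parallel>z\<parallel>\<^sup>2\<close>, one has \<open>p (M + p)\<^sup>2 = z w\<^sup>2 z\<^sup>*\<close>. Negativity of \<open>z\<^sup>* z\<close> bounds the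
  right side by \<open>M\<^sup>3\<close>, whereas the left side dominates \<open>2 M p\<^sup>2\<close>, whose norm is \<open>2 M\<^sup>3\<close>.\<close>

lemma cpos_antisym:
  fixes z :: "'a::cstar_algebra"
  assumes p: "cpos (z * star z)" and q: "cpos (- (star z * z))"
  shows "z = 0"
proof (rule ccontr)
  assume "z \<noteq> 0"
  define M where "M = (norm z)\<^sup>2"
  have M: "0 < M" using \<open>z \<noteq> 0\<close> by (simp add: M_def)
  define p where "p = z * star z"
  define w where "w = M *\<^sub>R 1 + star z * z"
  obtain s where s: "cpos s" "s * s = p" using cpos_sqrt[OF p] unfolding p_def by blast
  have sp: "star p = p" by (simp add: p_def star_mult star_star)
  have np: "norm p = M" by (simp add: p_def M_def norm_mult_star)
  have "norm (- (star z * z)) = M" by (simp add: M_def cstar_identity)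
  \<comment> \<open>The element \<open>- (star z * z)\<close> is positive of norm \<open>M\<close>,
    and \<open>M\<close> minus this element is \<open>w\<close>.\<close>
  then have nw: "norm w \<le> M"
    using cpos_norm_diff(1)[OF q] by (simp add: w_def)
  let ?b = "M\<^sup>2 *\<^sub>R p + (2 * M) *\<^sub>R (p * p) + p * p * p"
  have b: "?b = z * (w * w) * star z"
    by (simp add: w_def p_def algebra_simps power2_eq_square scaleR_2 flip: scaleR_scaleR)
  have "norm ?b \<le> norm z * (norm w * norm w) * norm (star z)"
    unfolding b by (meson mult_left_mono mult_right_mono norm_ge_zero norm_mult_ineq order_trans)
  also have "\<dots> = norm w * norm w * M" by (simp add: M_def power2_eq_square)
  also have "\<dots> \<le> M * M * M" using nw M by (intro mult_right_mono mult_mono) auto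
  finally have 1: "norm ?b \<le> M * M * M" .
  have "cpos ((2 * M) *\<^sub>R (p * p))" using M by (intro cpos_scaleR cpos_square sp) simp
  \<comment> \<open>The cube of \<open>p\<close> is the square of the selfadjoint element
    \<open>s * s * s\<close>.\<close>
  moreover have "cpos (p * p * p)"
  proof -
    have "star (s * s * s) = s * s * s"
      using cpos_selfadjoint[OF s(1)] by (simp add: star_mult mult.assoc)
    from cpos_square[OF this] show ?thesis by (simp add: s(2)[symmetric] mult.assoc)
  qed
  then have "cpos (?b - (2 * M) *\<^sub>R (p * p))"
    using cpos_add[OF cpos_scaleR[OF p, of "M\<^sup>2"]] M by (simp add: p_def)
  ultimately have "norm ((2 * M) *\<^sub>R (p * p)) \<le> norm ?b" by (rule cpos_norm_mono)
  then have "norm ((2 * M) *\<^sub>R (p * p)) \<le> M * M * M" using 1 by (rule order_trans)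
  then show False
    using M norm_square_selfadjoint[OF sp] by (simp add: np power2_eq_square)
qed

text \<open>For \<open>a = y\<^sup>* y\<close> let \<open>m = |a|\<close> and \<open>n = m - a\<close>, twice the negative part of \<open>a\<close>. Then \<open>z = y n\<close> satisfies
  \<open>z\<^sup>* z = n a n = - m n\<^sup>2 \<le> 0\<close>, while \<open>z z\<^sup>* + z\<^sup>* z\<close> is a sum of selfadjoint squares; so \<open>z = 0\<close> and then \<open>n = 0\<close>.\<close>

lemma cpos_star_mult:
  fixes y :: "'a::cstar_algebra"
  shows "cpos (star y * y)"
proof -
  define a where "a = star y * y"
  have sa: "star a = a" by (simp add: a_def star_mult star_star)
  obtain m where m: "cpos m" "m * m = a * a" "\<And>z. z * (a * a) = (a * a) * z \<Longrightarrow> z * m = m * z"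
    using cpos_sqrt[OF cpos_square[OF sa]] by blast
  \<comment> \<open>The root of \<open>m\<close> exhibits \<open>m n n\<close> as the square of the
    selfadjoint element \<open>r n\<close>.\<close>
  obtain r where r: "cpos r" "r * r = m" "\<And>z. z * m = m * z \<Longrightarrow> z * r = r * z"
    using cpos_sqrt[OF m(1)] by blast
  have am: "a * m = m * a" by (rule m(3)) (simp add: mult.assoc)
  define n where "n = m - a"
  have sn: "star n = n" by (simp add: n_def star_diff sa cpos_selfadjoint[OF m(1)])
  have nr: "n * r = r * n" by (rule r(3)) (simp add: n_def algebra_simps am)
  have na: "n * a = - (m * n)" by (simp add: n_def algebra_simps m(2))
  define z where "z = y * n"
  have "star z * z = n * a * n" by (simp add: z_def star_mult sn a_def mult.assoc)
  also have "\<dots> = - (r * n * (r * n))"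
    using nr by (simp add: na r(2)[symmetric] mult.assoc) (metis mult.assoc)
  finally have zz: "- (star z * z) = r * n * (r * n)" by simp
  have srn: "star (r * n) = r * n" by (simp add: star_mult sn cpos_selfadjoint[OF r(1)] nr)
  have neg: "cpos (- (star z * z))" unfolding zz by (rule cpos_square[OF srn])
  \<comment> \<open>Up to sign, \<open>?P\<close> and \<open>?Q\<close> are twice the real and
    imaginary parts of \<open>z\<close>; the cross terms cancel in the sum of their squares.\<close>
  let ?P = "z + star z" and ?Q = "\<i> *\<^sub>C (z - star z)"
  have "star ?Q = ?Q" by (simp add: star_scaleC star_diff star_star algebra_simps
      complex_vector.scale_right_diff_distrib)
  moreover have "star ?P = ?P" by (simp add: star_add star_star add.commute)
  ultimately have "cpos ((1/2) *\<^sub>R (?P * ?P + ?Q * ?Q))"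
    by (intro cpos_scaleR cpos_add cpos_square) auto
  also have "(1/2) *\<^sub>R (?P * ?P + ?Q * ?Q) = z * star z + star z * z"
  proof -
    have "?P * ?P + ?Q * ?Q = 2 *\<^sub>R (z * star z + star z * z)"
      by (simp add: mult_scaleC_left mult_scaleC_right scaleC_scaleC algebra_simps scaleR_2)
    then show ?thesis by simp
  qed
  finally have "cpos (z * star z)" using cpos_add[OF _ neg] by fastforce
  then have "z = 0" using neg by (rule cpos_antisym)
  then have "r * n * (r * n) = 0" using zz by simp
  then have "r * n = 0" using norm_square_selfadjoint[OF srn] by simp
  then have mn: "m * n = 0" by (simp add: r(2)[symmetric] mult.assoc)
  have "n * m = m * n" by (simp add: n_def algebra_simps am)
  \<comment> \<open>Here \<open>n n = n m - n a\<close>, and both \<open>n m\<close> and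
    \<open>- n a\<close> equal \<open>m n\<close>, which vanishes.\<close>
  then have "n * n = 0" using na mn by (simp add: n_def right_diff_distrib) 
  then have "n = 0" using norm_square_selfadjoint[OF sn] by simp
  then show ?thesis using m(1) by (simp add: n_def a_def)
qed

lemma cpos_mult_star: "cpos (y * star y)"
  using cpos_star_mult[of "star y"] by (simp add: star_star)

lemma cpos_imp_cstar_positive: "cpos h \<Longrightarrow> cstar_positive h"
  unfolding cstar_positive_def by (metis cpos_sqrt cpos_selfadjoint)

text \<open>The remaining terms form a positive sum, so monotonicity of the norm applies. This makes
  each coordinate continuous for the module norm.\<close>

lemma norm_le_norm_sum_mult_star:
  fixes y :: "'i \<Rightarrow> 'a::cstar_algebra"
  assumes "finite I" "k \<in> I"
  shows "(norm (y k))\<^sup>2 \<le> norm (\<Sum>i\<in>I. y i * star (y i))"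
proof -
  have "(\<Sum>i\<in>I. y i * star (y i)) - y k * star (y k) = (\<Sum>i\<in>I - {k}. y i * star (y i))"
    using assms by (simp add: sum_diff1)
  then have "norm (y k * star (y k)) \<le> norm (\<Sum>i\<in>I. y i * star (y i))"
    by (intro cpos_norm_mono cpos_mult_star) (simp add: cpos_sum cpos_mult_star)
  then show ?thesis by (simp add: norm_mult_star)
qed

section \<open>Inner product modules with a finite frame\<close>

lemma sum_fun_apply: "(\<Sum>i\<in>I. f i) x = (\<Sum>i\<in>I. f i x)"
  by (induction I rule: infinite_finite_induct) simp_all

text \<open>Isolates what the Hilbert module argument takes from the bundle. Positivity and
  definiteness of \<open>ip\<close> are left to be derived from the reconstruction formula
  \<open>frame\<close>.\<close>

locale framed_module =
  fixes B :: "'b::complex_star_algebra set"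
    and \<iota> :: "'b \<Rightarrow> 'a::cstar_algebra"
    and act :: "'b \<Rightarrow> 'e::complex_vector \<Rightarrow> 'e"
    and E :: "'e set"
    and ip :: "'e \<Rightarrow> 'e \<Rightarrow> 'b"
    and d :: nat
    and t :: "nat \<Rightarrow> 'e"
  assumes B: "star_subalgebra B"
    and completion: "cstar_completion B \<iota>"
    and E: "csubspace E"
    and act_closed: "a \<in> B \<Longrightarrow> x \<in> E \<Longrightarrow> act a x \<in> E"
    and act_add: "a \<in> B \<Longrightarrow> x \<in> E \<Longrightarrow> y \<in> E \<Longrightarrow> act a (x + y) = act a x + act a y"
    and act_add_left: "a \<in> B \<Longrightarrow> b \<in> B \<Longrightarrow> x \<in> E \<Longrightarrow> act (a + b) x = act a x + act b x"
    and act_mult: "a \<in> B \<Longrightarrow> b \<in> B \<Longrightarrow> x \<in> E \<Longrightarrow> act (a * b) x = act a (act b x)"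
    and act_scaleC_one: "x \<in> E \<Longrightarrow> act (c *\<^sub>C 1) x = c *\<^sub>C x"
    and ip_closed: "x \<in> E \<Longrightarrow> y \<in> E \<Longrightarrow> ip x y \<in> B"
    and ip_add: "x \<in> E \<Longrightarrow> y \<in> E \<Longrightarrow> z \<in> E \<Longrightarrow> ip (x + y) z = ip x z + ip y z"
    and ip_act: "a \<in> B \<Longrightarrow> x \<in> E \<Longrightarrow> y \<in> E \<Longrightarrow> ip (act a x) y = a * ip x y"
    and ip_star: "x \<in> E \<Longrightarrow> y \<in> E \<Longrightarrow> ip y x = star (ip x y)"
    and frame_in: "k < d \<Longrightarrow> t k \<in> E"
    and frame: "x \<in> E \<Longrightarrow> x = (\<Sum>k<d. act (ip x (t k)) (t k))"
begin

lemma base_subspace: "csubspace B" and base_mult: "x \<in> B \<Longrightarrow> y \<in> B \<Longrightarrow> x * y \<in> B"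
  using B unfolding star_subalgebra_def by blast+

lemmas base_zero = complex_vector.subspace_0[OF base_subspace]
  and base_sum = complex_vector.subspace_sum[OF base_subspace]

lemma emb_hom: "star_hom_on B \<iota>" and emb_inj: "inj_on \<iota> B" and emb_dense: "closure (\<iota> ` B) = UNIV"
  using completion by (auto simp: cstar_completion_def)

lemmas emb_add = emb_hom[unfolded star_hom_on_def, THEN conjunct1, rule_format]
  and emb_mult = emb_hom[unfolded star_hom_on_def, THEN conjunct2, THEN conjunct2, THEN conjunct2,
    THEN conjunct1, rule_format]
  and emb_star = emb_hom[unfolded star_hom_on_def, THEN conjunct2, THEN conjunct2, THEN conjunct2,
    THEN conjunct2, rule_format]

lemma emb_zero: "\<iota> 0 = 0"
  using emb_add[OF base_zero base_zero] by simp

lemma emb_sum: "(\<And>i. i \<in> I \<Longrightarrow> f i \<in> B) \<Longrightarrow> \<iota> (sum f I) = (\<Sum>i\<in>I. \<iota> (f i))"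
  by (induction I rule: infinite_finite_induct) (simp_all add: emb_zero emb_add base_sum)

lemma ip_sum: "(\<And>i. i \<in> I \<Longrightarrow> f i \<in> E) \<Longrightarrow> y \<in> E \<Longrightarrow> ip (sum f I) y = (\<Sum>i\<in>I. ip (f i) y)"
proof (induction I rule: infinite_finite_induct)
  have "ip 0 y = 0" if "y \<in> E" for y
    using ip_add[of 0 0 y] complex_vector.subspace_0[OF E] that by simp
  then show "ip (sum f {}) y = (\<Sum>i\<in>{}. ip (f i) y)" if "y \<in> E" for y using that by simp
  then show "ip (sum f I) y = (\<Sum>i\<in>I. ip (f i) y)" if "infinite I" "y \<in> E" for I y using that by simp
next
  case (insert i I)
  then show ?case by (simp add: ip_add complex_vector.subspace_sum[OF E])
qed

text \<open>Pair the reconstruction of \<open>x\<close> with \<open>y\<close>. For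
  \<open>y = t l\<close> this says that coordinate vectors satisfy v Q = v; for general
  \<open>y\<close> it is the Parseval identity.\<close>

lemma ip_frame: "x \<in> E \<Longrightarrow> y \<in> E \<Longrightarrow> ip x y = (\<Sum>k<d. ip x (t k) * ip (t k) y)"
  using ip_sum[of "{..<d}" "\<lambda>k. act (ip x (t k)) (t k)" y] frame[of x]
  by (simp add: ip_act ip_closed act_closed frame_in)

text \<open>The value 0 from \<open>d\<close> on makes equality of coordinate vectors equality of
  functions.\<close>

definition coords :: "'e \<Rightarrow> nat \<Rightarrow> 'a"
  where "coords x = (\<lambda>k. if k < d then \<iota> (ip x (t k)) else 0)"

text \<open>Row vectors \<open>v\<close> with \<open>v Q = v\<close>, where \<open>Q\<^sub>k\<^sub>l = \<iota> \<langle>t\<^sub>k, t\<^sub>l\<rangle>\<close> is a projection by the frame property.\<close>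

definition gram_range :: "(nat \<Rightarrow> 'a) set"
  where "gram_range = {v. (\<forall>k. \<not> k < d \<longrightarrow> v k = 0) \<and>
    (\<forall>l<d. v l = (\<Sum>k<d. v k * \<iota> (ip (t k) (t l))))}"

definition coord_act :: "'a \<Rightarrow> (nat \<Rightarrow> 'a) \<Rightarrow> nat \<Rightarrow> 'a"
  where "coord_act a v = (\<lambda>k. a * v k)"

definition coord_ip :: "(nat \<Rightarrow> 'a) \<Rightarrow> (nat \<Rightarrow> 'a) \<Rightarrow> 'a"
  where "coord_ip v w = (\<Sum>k<d. v k * star (w k))"

lemma coords_in: "x \<in> E \<Longrightarrow> coords x \<in> gram_range"
proof -
  assume x: "x \<in> E"
  have "\<iota> (ip x (t l)) = (\<Sum>k<d. \<iota> (ip x (t k)) * \<iota> (ip (t k) (t l)))" if "l < d" for l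
    by (subst ip_frame, simp_all add: x that frame_in, subst emb_sum)
      (auto simp: x that emb_mult base_mult ip_closed frame_in)
  then show ?thesis by (simp add: coords_def gram_range_def)
qed

lemma coords_add: "x \<in> E \<Longrightarrow> y \<in> E \<Longrightarrow> coords (x + y) = coords x + coords y"
  by (simp add: coords_def fun_eq_iff ip_add emb_add ip_closed frame_in)

lemma coords_diff: "x \<in> E \<Longrightarrow> y \<in> E \<Longrightarrow> coords (x - y) = coords x - coords y"
  using coords_add[of "x - y" y] complex_vector.subspace_diff[OF E] by simp

lemma coords_sum: "(\<And>i. i \<in> I \<Longrightarrow> f i \<in> E) \<Longrightarrow> coords (sum f I) = (\<Sum>i\<in>I. coords (f i))"
proof (induction I rule: infinite_finite_induct)
  case (insert i I)
  then show ?case by (simp add: coords_add complex_vector.subspace_sum[OF E])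
next
  case empty
  show ?case using coords_add[of 0 0] complex_vector.subspace_0[OF E] by simp
next
  case (infinite I)
  show ?case using infinite coords_add[of 0 0] complex_vector.subspace_0[OF E] by simp
qed

lemma coords_act: "b \<in> B \<Longrightarrow> x \<in> E \<Longrightarrow> coords (act b x) = coord_act (\<iota> b) (coords x)"
  by (simp add: coords_def coord_act_def fun_eq_iff ip_act emb_mult ip_closed frame_in)

lemma coord_ip_coords: "x \<in> E \<Longrightarrow> y \<in> E \<Longrightarrow> coord_ip (coords x) (coords y) = \<iota> (ip x y)"
proof -
  assume x: "x \<in> E" and y: "y \<in> E"
  have "\<iota> (ip (t k) y) = star (\<iota> (ip y (t k)))" if "k < d" for k
    by (simp add: ip_star[OF y frame_in[OF that]] emb_star ip_closed y frame_in that)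
  moreover have "\<iota> (ip x y) = (\<Sum>k<d. \<iota> (ip x (t k)) * \<iota> (ip (t k) y))"
    by (subst ip_frame, simp_all add: x y, subst emb_sum)
      (auto simp: x y emb_mult base_mult ip_closed frame_in)
  ultimately show ?thesis by (simp add: coords_def coord_ip_def)
qed

text \<open>Row k of Q is \<open>coords (t k)\<close>, so this is v Q = v read by rows. It yields
  both generation by the image of \<open>E\<close> and, after approximating the coefficients,
  density.\<close>

lemma gram_range_expand:
  assumes "v \<in> gram_range"
  shows "v = (\<Sum>k<d. coord_act (v k) (coords (t k)))"
proof
  fix l
  show "v l = (\<Sum>k<d. coord_act (v k) (coords (t k))) l"
  proof (cases "l < d")
    case True
    then have "v l = (\<Sum>k<d. v k * \<iota> (ip (t k) (t l)))"
      using assms unfolding gram_range_def by blast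
    then show ?thesis using True by (simp add: sum_fun_apply coord_act_def coords_def)
  next
    case False
    then show ?thesis using assms by (simp add: gram_range_def sum_fun_apply coord_act_def coords_def)
  qed
qed

lemma csubspace_gram_range: "csubspace gram_range"
  unfolding complex_vector.subspace_def
proof (intro conjI ballI allI)
  fix v w c assume "v \<in> gram_range" "w \<in> gram_range"
  then show "v + w \<in> gram_range"
    by (simp add: gram_range_def distrib_right sum.distrib)
  show "c *\<^sub>C v \<in> gram_range"
    using \<open>v \<in> gram_range\<close>
    by (simp add: gram_range_def mult_scaleC_left flip: complex_vector.scale_sum_right)
qed (simp add: gram_range_def)

lemma norm_component_le: "k < d \<Longrightarrow> norm (v k) \<le> module_norm id coord_ip v"
  unfolding module_norm_def coord_ip_def
  using norm_le_norm_sum_mult_star[of "{..<d}" k v] by (simp add: real_le_rsqrt)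

lemma module_norm_tendsto_0:
  assumes "\<And>k. k < d \<Longrightarrow> (\<lambda>n. X n k) \<longlonglongrightarrow> 0"
  shows "(\<lambda>n. module_norm id coord_ip (X n)) \<longlonglongrightarrow> 0"
proof -
  have "(\<lambda>n. coord_ip (X n) (X n)) \<longlonglongrightarrow> (\<Sum>k<d. 0 * star 0)"
    unfolding coord_ip_def by (intro tendsto_intros tendsto_star assms) auto
  then have "(\<lambda>n. sqrt (norm (coord_ip (X n) (X n)))) \<longlonglongrightarrow> sqrt (norm (0::'a))"
    by (intro tendsto_real_sqrt tendsto_norm) simp
  then show ?thesis by (simp add: module_norm_def)
qed

lemma left_hilbert_module_gram_range: "left_hilbert_module UNIV id coord_act gram_range coord_ip"
  unfolding left_hilbert_module_def
proof (intro conjI allI impI)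
  show "star_subalgebra (UNIV :: 'a set)"
    by (simp add: star_subalgebra_def)
  show "star_hom_on UNIV (id :: 'a \<Rightarrow> 'a)"
    by (simp add: star_hom_on_def)
  show "bij_betw (id :: 'a \<Rightarrow> 'a) UNIV UNIV" by simp
  show "left_inner_product_module UNIV id coord_act gram_range coord_ip"
    unfolding left_inner_product_module_def
  proof (intro conjI ballI allI impI)
    show "csubspace gram_range" by (rule csubspace_gram_range)
    fix a b :: 'a and v w z :: "nat \<Rightarrow> 'a"
    show "coord_act a (v + w) = coord_act a v + coord_act a w"
      "coord_act (a + b) v = coord_act a v + coord_act b v"
      "coord_act (a * b) v = coord_act a (coord_act b v)"
      "\<And>c. coord_act (c *\<^sub>C 1) v = c *\<^sub>C v"
      "coord_ip (v + w) z = coord_ip v z + coord_ip w z"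
      "coord_ip (coord_act a v) w = a * coord_ip v w"
      "coord_ip w v = star (coord_ip v w)"
      by (simp_all add: fun_eq_iff coord_act_def coord_ip_def algebra_simps mult_scaleC_left
          sum.distrib sum_distrib_left star_sum star_mult star_star)
    show "cstar_positive (id (coord_ip v v))"
      by (simp add: coord_ip_def cpos_imp_cstar_positive cpos_sum cpos_mult_star)
    assume v: "v \<in> gram_range"
    then show "coord_act a v \<in> gram_range"
      by (simp add: gram_range_def coord_act_def mult.assoc flip: sum_distrib_left)
    assume "coord_ip v v = 0"
    then have "v k = 0" if "k < d" for k
      using norm_component_le[OF that, of v] by (simp add: module_norm_def)
    then show "v = 0" using v by (auto simp: gram_range_def fun_eq_iff)
  qed auto
  fix X :: "nat \<Rightarrow> nat \<Rightarrow> 'a"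
  assume X: "range X \<subseteq> gram_range"
    and cauchy: "\<forall>r>0. \<exists>N. \<forall>m\<ge>N. \<forall>n\<ge>N. module_norm id coord_ip (X m - X n) < r"
  have "\<exists>l. (\<lambda>n. X n k) \<longlonglongrightarrow> l" if "k < d" for k
  proof -
    have "Cauchy (\<lambda>n. X n k)"
      unfolding Cauchy_iff
    proof (intro allI impI)
      fix r :: real assume "0 < r"
      then obtain N where "\<forall>m\<ge>N. \<forall>n\<ge>N. module_norm id coord_ip (X m - X n) < r"
        using cauchy by blast
      moreover have "norm (X m k - X n k) \<le> module_norm id coord_ip (X m - X n)" for m n
        using norm_component_le[OF that, of "X m - X n"] by simp
      ultimately show "\<exists>N. \<forall>m\<ge>N. \<forall>n\<ge>N. norm (X m k - X n k) < r"
        using order.strict_trans1 by blast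
    qed
    then show ?thesis by (simp add: Cauchy_convergent_iff convergent_def)
  qed
  then obtain l where l: "\<And>k. k < d \<Longrightarrow> (\<lambda>n. X n k) \<longlonglongrightarrow> l k" by metis
  define x where "x = (\<lambda>k. if k < d then l k else 0)"
  have lim: "(\<lambda>n. X n k) \<longlonglongrightarrow> x k" if "k < d" for k
    using l that by (simp add: x_def)
  \<comment> \<open>The equation v Q = v passes to the coordinatewise limit because multiplication
    is continuous.\<close>
  have "x i = (\<Sum>k<d. x k * \<iota> (ip (t k) (t i)))" if "i < d" for i
  proof (rule LIMSEQ_unique[OF lim[OF that]])
    have "(\<lambda>n. X n i) = (\<lambda>n. \<Sum>k<d. X n k * \<iota> (ip (t k) (t i)))"
      using X that unfolding gram_range_def by blast
    moreover have "(\<lambda>n. \<Sum>k<d. X n k * \<iota> (ip (t k) (t i))) \<longlonglongrightarrow> (\<Sum>k<d. x k * \<iota> (ip (t k) (t i)))"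
      by (intro tendsto_intros lim) auto
    ultimately show "(\<lambda>n. X n i) \<longlonglongrightarrow> (\<Sum>k<d. x k * \<iota> (ip (t k) (t i)))" by simp
  qed
  then have "x \<in> gram_range" by (simp add: gram_range_def x_def)
  moreover have "(\<lambda>n. module_norm id coord_ip (X n - x)) \<longlonglongrightarrow> 0"
    by (rule module_norm_tendsto_0) (simp add: LIM_zero lim)
  ultimately show "\<exists>x\<in>gram_range. (\<lambda>n. module_norm id coord_ip (X n - x)) \<longlonglongrightarrow> 0" by blast
qed

lemma coords_approx:
  assumes "v \<in> gram_range" "0 < r"
  shows "\<exists>x\<in>E. module_norm id coord_ip (v - coords x) < r"
proof -
  have "\<forall>k. \<exists>b. (\<forall>n. b n \<in> B) \<and> (\<lambda>n. \<iota> (b n)) \<longlonglongrightarrow> v k"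
  proof
    fix k
    have "v k \<in> closure (\<iota> ` B)" by (simp add: emb_dense)
    then obtain y where "\<And>n. y n \<in> \<iota> ` B" "y \<longlonglongrightarrow> v k"
      unfolding closure_sequential by blast
    then have "\<forall>n. \<exists>b. b \<in> B \<and> y n = \<iota> b" by blast
    from choice[OF this] obtain b where "\<forall>n. b n \<in> B" "y = (\<lambda>n. \<iota> (b n))" by blast
    with \<open>y \<longlonglongrightarrow> v k\<close> show "\<exists>b. (\<forall>n. b n \<in> B) \<and> (\<lambda>n. \<iota> (b n)) \<longlonglongrightarrow> v k" by blast
  qed
  from choice[OF this] obtain b where
    b: "\<And>k n. b k n \<in> B" "\<And>k. (\<lambda>n. \<iota> (b k n)) \<longlonglongrightarrow> v k" by auto
  \<comment> \<open>The approximating coefficients need not lie in the range of Q; the coordinates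
    of \<open>x n\<close> are their product with Q and tend to v Q = v.\<close>
  define x where "x = (\<lambda>n. \<Sum>k<d. act (b k n) (t k))"
  have x: "x n \<in> E" for n
    unfolding x_def using b frame_in by (intro complex_vector.subspace_sum[OF E]) (auto intro: act_closed)
  have cx: "coords (x n) = (\<Sum>k<d. coord_act (\<iota> (b k n)) (coords (t k)))" for n
    unfolding x_def by (subst coords_sum) (auto simp: act_closed b frame_in coords_act)
  have "(\<lambda>n. (v - coords (x n)) l) \<longlonglongrightarrow> 0" for l
  proof -
    have "(\<lambda>n. \<Sum>k<d. \<iota> (b k n) * coords (t k) l) \<longlonglongrightarrow> (\<Sum>k<d. v k * coords (t k) l)"
      by (intro tendsto_intros b)
    also have "(\<Sum>k<d. v k * coords (t k) l) = v l"
      using fun_cong[OF gram_range_expand[OF assms(1)], of l] by (simp add: sum_fun_apply coord_act_def)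
    finally have "(\<lambda>n. v l - (\<Sum>k<d. \<iota> (b k n) * coords (t k) l)) \<longlonglongrightarrow> v l - v l"
      by (intro tendsto_intros)
    then show ?thesis by (simp add: cx sum_fun_apply coord_act_def)
  qed
  then have "(\<lambda>n. module_norm id coord_ip (v - coords (x n))) \<longlonglongrightarrow> 0"
    by (rule module_norm_tendsto_0)
  then have "eventually (\<lambda>n. module_norm id coord_ip (v - coords (x n)) < r) sequentially"
    using \<open>0 < r\<close> by (rule order_tendstoD)
  then show ?thesis
    using x unfolding eventually_sequentially by blast
qed

lemma completes_module_coords: "completes_module B \<iota> act E ip coord_act gram_range coord_ip coords"
  unfolding completes_module_def
proof (intro conjI ballI allI impI)
  fix v assume "v \<in> gram_range"
  then show "\<exists>m a x. (\<forall>k<m. x k \<in> E) \<and> v = (\<Sum>k<(m::nat). coord_act (a k) (coords (x k)))"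
    using gram_range_expand frame_in by blast
qed (auto simp: coords_in coords_add coords_act coord_ip_coords coords_approx)

lemma module_norm_coords: "x \<in> E \<Longrightarrow> module_norm id coord_ip (coords x) = module_norm \<iota> ip x"
  by (simp add: module_norm_def coord_ip_coords)

text \<open>Positivity is read off in coordinates. If \<open>ip x x = 0\<close>, all coordinates
  vanish, hence all \<open>ip x (t k)\<close> by injectivity of \<iota>, and reconstruction gives
  \<open>x = 0\<close>.\<close>

lemma left_inner_product_module: "left_inner_product_module B \<iota> act E ip"
  unfolding left_inner_product_module_def
proof (intro conjI ballI allI impI)
  fix x assume x: "x \<in> E"
  show "cstar_positive (\<iota> (ip x x))"
    unfolding coord_ip_coords[OF x x, symmetric] coord_ip_def
    by (intro cpos_imp_cstar_positive cpos_sum cpos_mult_star)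
  assume "ip x x = 0"
  then have "module_norm id coord_ip (coords x) = 0"
    unfolding module_norm_coords[OF x] by (simp add: module_norm_def emb_zero)
  then have "\<iota> (ip x (t k)) = 0" if "k < d" for k
    using norm_component_le[OF that, of "coords x"] that by (simp add: coords_def)
  then have ip0: "ip x (t k) = 0" if "k < d" for k
    using that inj_onD[OF emb_inj, of "ip x (t k)" 0] by (simp add: emb_zero base_zero ip_closed x frame_in)
  have "act 0 (t k) = 0" if "k < d" for k
    using act_scaleC_one[OF frame_in[OF that], of 0] by simp
  then show "x = 0" using frame[OF x] ip0 by simp
qed ((rule E act_closed act_add act_add_left act_mult act_scaleC_one ip_closed ip_add ip_act ip_star;
    assumption)+)

lemma left_hilbert_module:
  assumes surj: "\<iota> ` B = UNIV"
  shows "left_hilbert_module B \<iota> act E ip"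
  unfolding left_hilbert_module_def
proof (intro conjI allI impI)
  show "bij_betw \<iota> B UNIV" using emb_inj surj by (simp add: bij_betw_def)
  fix X :: "nat \<Rightarrow> 'e"
  assume "range X \<subseteq> E"
    and cauchy: "\<forall>r>0. \<exists>N. \<forall>m\<ge>N. \<forall>n\<ge>N. module_norm \<iota> ip (X m - X n) < r"
  then have X: "X n \<in> E" for n by auto
  have norm_eq: "module_norm id coord_ip (coords x - coords y) = module_norm \<iota> ip (x - y)"
    if "x \<in> E" "y \<in> E" for x y
    using that by (simp add: module_norm_coords complex_vector.subspace_diff[OF E] flip: coords_diff)
  have "range (\<lambda>n. coords (X n)) \<subseteq> gram_range" using X coords_in by auto
  moreover have "\<forall>r>0. \<exists>N. \<forall>m\<ge>N. \<forall>n\<ge>N. module_norm id coord_ip (coords (X m) - coords (X n)) < r"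
    using cauchy by (simp add: norm_eq X)
  ultimately obtain v where v: "v \<in> gram_range"
      "(\<lambda>n. module_norm id coord_ip (coords (X n) - v)) \<longlonglongrightarrow> 0"
    using left_hilbert_module_gram_range unfolding left_hilbert_module_def by meson
  \<comment> \<open>Lifting the coefficients of the limit \<open>v\<close> to \<open>B\<close> and
    combining the frame with them produces a preimage of \<open>v\<close> under
    \<open>coords\<close>.\<close>
  have "\<exists>b\<in>B. \<iota> b = v k" for k using surj by (metis imageE iso_tuple_UNIV_I)
  then obtain b where b: "\<And>k. b k \<in> B" "\<And>k. \<iota> (b k) = v k" by metis
  define x where "x = (\<Sum>k<d. act (b k) (t k))"
  have x: "x \<in> E"
    unfolding x_def using b frame_in by (intro complex_vector.subspace_sum[OF E]) (auto intro: act_closed)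
  have "coords x = (\<Sum>k<d. coord_act (v k) (coords (t k)))"
    unfolding x_def by (subst coords_sum) (auto simp: act_closed b frame_in coords_act)
  then have "coords x = v" using gram_range_expand[OF v(1)] by simp
  then show "\<exists>x\<in>E. (\<lambda>n. module_norm \<iota> ip (X n - x)) \<longlonglongrightarrow> 0"
    using v(2) x by (intro bexI[of _ x]) (simp_all add: X flip: norm_eq)
qed (fact B emb_hom left_inner_product_module)+

end

section \<open>Tensor products and orthonormal systems\<close>

lemma complex_linear_sum: "complex_linear f \<Longrightarrow> f (sum g I) = (\<Sum>i\<in>I. f (g i))"
  by (rule complex_vector.linear_sum)

lemma complex_linear_id: "complex_linear id" "complex_linear (\<lambda>x. x)"
  by (auto intro: complex_linearI)

lemma tensor_sum_left: "(\<Sum>i\<in>I. f i) \<otimes> z = (\<Sum>i\<in>I. f i \<otimes> z)"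
  by (rule complex_linear_sum) (simp add: complex_linear_iff tensor_add_left tensor_scaleC_left)

lemma tensor_sum_right: "z \<otimes> (\<Sum>i\<in>I. f i) = (\<Sum>i\<in>I. z \<otimes> f i)"
  by (rule complex_linear_sum) (simp add: complex_linear_iff tensor_add_right tensor_scaleC_right)

lemma tensor_zero_left [simp]: "0 \<otimes> z = 0" and tensor_zero_right [simp]: "w \<otimes> 0 = 0"
  using tensor_sum_left[of "\<lambda>_. 0" "{}" z] tensor_sum_right[of w "\<lambda>_. 0" "{}"] by simp_all

lemma tensor_map:
  assumes "complex_linear f" "complex_linear g"
  shows "complex_linear (tensor_map f g)" "tensor_map f g (x \<otimes> y) = f x \<otimes> g y"
proof -
  have "cbilinear (\<lambda>x y. f x \<otimes> g y)"
    using assms by (simp add: cbilinear_iff complex_linear_iff tensor_add_left tensor_add_right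
        tensor_scaleC_left tensor_scaleC_right)
  then show "complex_linear (tensor_map f g)" "tensor_map f g (x \<otimes> y) = f x \<otimes> g y"
    unfolding tensor_map_def by (rule tensor_lift)+
qed

lemma tensor_assoc:
  fixes x :: "'a::complex_vector" and y :: "'b::complex_vector" and z :: "'c::complex_vector"
  shows "complex_linear (tensor_assoc :: (('a, 'b) tensor, 'c) tensor \<Rightarrow> ('a, ('b, 'c) tensor) tensor)"
    "tensor_assoc ((x \<otimes> y) \<otimes> z) = x \<otimes> (y \<otimes> z)"
proof -
  define A where "A = (\<lambda>z :: 'c.
    tensor_lift (\<lambda>(x :: 'a) (y :: 'b). x \<otimes> (y \<otimes> z)))"
  have bil: "cbilinear (\<lambda>(x :: 'a) (y :: 'b). x \<otimes> (y \<otimes> z))" for z :: 'c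
    by (simp add: cbilinear_iff tensor_add_left tensor_add_right tensor_scaleC_left tensor_scaleC_right)
  have lin: "complex_linear (A z)" and app: "A z (x \<otimes> y) = x \<otimes> (y \<otimes> z)" for x y z
    unfolding A_def by (rule tensor_lift[OF bil])+
  have "A (z + w) t = A z t + A w t" for z w t
    by (induction t) (simp_all add: app complex_linearD(1)[OF lin] tensor_add_right add_ac)
  moreover have "A (c *\<^sub>C z) t = c *\<^sub>C A z t" for c z t
    by (induction t) (simp_all add: app complex_linearD(1)[OF lin] tensor_scaleC_right scaleC_add_right)
  ultimately have "cbilinear (\<lambda>t z. A z t)"
    by (simp add: cbilinear_iff complex_linearD[OF lin])
  note * = tensor_lift[OF this]
  have A: "tensor_assoc = tensor_lift (\<lambda>(s :: ('a, 'b) tensor) (z :: 'c). A z s)"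
    by (simp add: tensor_assoc_def A_def)
  show "complex_linear (tensor_assoc :: (('a, 'b) tensor, 'c) tensor \<Rightarrow> ('a, ('b, 'c) tensor) tensor)"
    "tensor_assoc ((x \<otimes> y) \<otimes> z) = x \<otimes> (y \<otimes> z)"
    unfolding A using *(1) by (simp_all add: *(2) app)
qed

text \<open>This is \<phi> \<otimes> id followed by the identification of the tensor product of the
  scalars and H with H; dual functionals \<phi> extract matrix entries.\<close>

definition contract_left :: "('v::complex_vector \<Rightarrow> complex) \<Rightarrow> ('v, 'h::complex_vector) tensor \<Rightarrow> 'h"
  where "contract_left \<phi> = tensor_lift (\<lambda>v h. \<phi> v *\<^sub>C h)"

lemma contract_left:
  assumes "complex_linear \<phi>"
  shows "complex_linear (contract_left \<phi>)" "contract_left \<phi> (v \<otimes> h) = \<phi> v *\<^sub>C h"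
proof -
  have "cbilinear (\<lambda>v h. \<phi> v *\<^sub>C h)"
    using assms by (simp add: cbilinear_iff complex_linear_iff scaleC_add_left scaleC_add_right
        scaleC_scaleC scaleC_complex_def mult.commute)
  then show "complex_linear (contract_left \<phi>)" "contract_left \<phi> (v \<otimes> h) = \<phi> v *\<^sub>C h"
    unfolding contract_left_def by (rule tensor_lift)+
qed

lemma tensor_sub_tensor: "v \<in> V \<Longrightarrow> v \<otimes> h \<in> tensor_sub V"
  unfolding tensor_sub_def by (rule complex_vector.span_base) auto

lemma csubspace_tensor_sub: "csubspace (tensor_sub V)"
  unfolding tensor_sub_def by (rule complex_vector.subspace_span)

lemma linear_eq_on_tensor_sub:
  assumes "complex_linear f" "complex_linear g" "\<And>v h. v \<in> V \<Longrightarrow> f (v \<otimes> h) = g (v \<otimes> h)"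
    and "t \<in> tensor_sub V"
  shows "f t = g t"
  by (rule complex_vector.linear_eq_on[OF assms(1,2) assms(4)[unfolded tensor_sub_def]])
    (auto intro: assms(3))

lemma contract_left_tensor_sub:
  assumes "complex_linear \<phi>" "\<And>v. v \<in> V \<Longrightarrow> \<phi> v = 0" "t \<in> tensor_sub V"
  shows "contract_left \<phi> t = 0"
  by (rule linear_eq_on_tensor_sub[of _ "\<lambda>_. 0" V, OF contract_left(1)[OF assms(1)]])
    (use assms in \<open>auto simp: contract_left intro: complex_linearI\<close>)

text \<open>On the subspace belonging to V, the map T \<otimes> id is thus independent of the chosen
  linear extension of T.\<close>

lemma tensor_map_eq_on_tensor_sub:
  assumes "complex_linear f" "complex_linear g" "\<And>v. v \<in> V \<Longrightarrow> f v = g v" "t \<in> tensor_sub V"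
  shows "tensor_map f id t = tensor_map g id t"
  by (rule linear_eq_on_tensor_sub[OF tensor_map(1)[OF assms(1)] tensor_map(1)[OF assms(2)] _ assms(4)])
    (simp_all add: tensor_map(2) assms complex_linear_id)

lemma complex_linear_extension:
  assumes V: "csubspace V"
    and f: "\<And>x y. x \<in> V \<Longrightarrow> y \<in> V \<Longrightarrow> f (x + y) = f x + f y"
      "\<And>c x. x \<in> V \<Longrightarrow> f (c *\<^sub>C x) = c *\<^sub>C f x"
  obtains g where "complex_linear g" "\<And>v. v \<in> V \<Longrightarrow> g v = f v"
proof -
  obtain A where A: "A \<subseteq> V" "complex_vector.independent A" "V \<subseteq> cspan A"
    using complex_vector.basis_exists[of V] by metis
  obtain g where g: "complex_linear g" "\<And>x. x \<in> A \<Longrightarrow> g x = f x"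
    using complex_vector.linear_independent_extend[OF A(2), of f] by blast
  have "v \<in> V \<and> g v = f v" if "v \<in> cspan A" for v
    using that
  proof (induction rule: complex_vector.span_induct_alt)
    case base
    have "f 0 = 0" using f(1)[of 0 0] complex_vector.subspace_0[OF V] by simp
    then show ?case using complex_vector.subspace_0[OF V] complex_vector.linear_0[OF g(1)] by simp
  next
    case (step c x y)
    then have "x \<in> V" using A by blast
    then show ?case
      using step V g f by (simp add: complex_linearD complex_vector.subspace_add complex_vector.subspace_scale)
  qed
  then show thesis using that[OF g(1)] A(3) by blast
qed

lemma sum_lessThan_add:
  fixes F :: "nat \<Rightarrow> 'a::comm_monoid_add"
  shows "(\<Sum>k<m + n. F k) = (\<Sum>k<m. F k) + (\<Sum>k<n. F (m + k))"
  by (induction n) (simp_all add: add_ac)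

lemma scaleC_delta: "(if P then 1 else 0) *\<^sub>C (y :: 'a::complex_vector) = (if P then y else 0)"
  by (simp add: scaleC_one)

lemma sum_scaleC_delta:
  fixes n :: nat and x :: "nat \<Rightarrow> 'a::complex_vector"
  assumes "j < n"
  shows "(\<Sum>i<n. (if i = j then 1 else 0) *\<^sub>C x i) = x j"
    "(\<Sum>i<n. (if j = i then 1 else 0) *\<^sub>C x i) = x j"
  using assms by (simp_all add: scaleC_delta)

section \<open>Orthonormal systems in subspaces\<close>

locale inner_product_subspace =
  fixes V :: "'v::complex_vector set" and ip :: "'v \<Rightarrow> 'v \<Rightarrow> complex"
  assumes subspace: "csubspace V" and ip: "inner_product_on V ip"
begin

lemmas ip_add = ip[unfolded inner_product_on_def, THEN conjunct1, rule_format]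
  and ip_scale = ip[unfolded inner_product_on_def, THEN conjunct2, THEN conjunct1, rule_format]
  and ip_cnj = ip[unfolded inner_product_on_def, THEN conjunct2, THEN conjunct2, THEN conjunct1,
    rule_format]
  and ip_pos = ip[unfolded inner_product_on_def, THEN conjunct2, THEN conjunct2, THEN conjunct2,
    rule_format]

lemmas add_in = complex_vector.subspace_add[OF subspace]
  and diff_in = complex_vector.subspace_diff[OF subspace]
  and scale_in = complex_vector.subspace_scale[OF subspace]
  and sum_in = complex_vector.subspace_sum[OF subspace]
  and zero_in = complex_vector.subspace_0[OF subspace]

lemma ip_zero: "y \<in> V \<Longrightarrow> ip 0 y = 0"
  using ip_add[of 0 0 y] zero_in by simp

lemma ip_diff: "x \<in> V \<Longrightarrow> y \<in> V \<Longrightarrow> z \<in> V \<Longrightarrow> ip (x - y) z = ip x z - ip y z"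
  using ip_add[of "x - y" y z] diff_in by simp

lemma ip_sum: "(\<And>i. i \<in> I \<Longrightarrow> f i \<in> V) \<Longrightarrow> y \<in> V \<Longrightarrow> ip (sum f I) y = (\<Sum>i\<in>I. ip (f i) y)"
  by (induction I rule: infinite_finite_induct) (simp_all add: ip_zero ip_add sum_in)

lemma ip_lincomb:
  "(\<And>i. i < n \<Longrightarrow> g i \<in> V) \<Longrightarrow> y \<in> V \<Longrightarrow>
    ip (\<Sum>i<n. c i *\<^sub>C g i) y = (\<Sum>i<n. c i * ip (g i) y)"
  by (subst ip_sum) (auto simp: scale_in ip_scale)

lemma ip_add_right: "x \<in> V \<Longrightarrow> y \<in> V \<Longrightarrow> z \<in> V \<Longrightarrow> ip x (y + z) = ip x y + ip x z"
  by (simp add: ip_cnj[of _ x] ip_add add_in)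

lemma ip_scale_right: "x \<in> V \<Longrightarrow> y \<in> V \<Longrightarrow> ip x (c *\<^sub>C y) = cnj c * ip x y"
  by (simp add: ip_cnj[of _ x] ip_scale scale_in)

lemma inner_product_subspace_subset: "csubspace W \<Longrightarrow> W \<subseteq> V \<Longrightarrow> inner_product_subspace W ip"
  by (unfold_locales, assumption, unfold inner_product_on_def)
    (intro conjI ballI allI impI ip_add ip_scale ip_cnj ip_pos; blast)

definition orthonormal :: "nat \<Rightarrow> (nat \<Rightarrow> 'v) \<Rightarrow> bool"
  where "orthonormal n g \<longleftrightarrow> (\<forall>i<n. g i \<in> V) \<and>
    (\<forall>i<n. \<forall>j<n. ip (g i) (g j) = (if i = j then 1 else 0))"

definition proj :: "nat \<Rightarrow> (nat \<Rightarrow> 'v) \<Rightarrow> 'v \<Rightarrow> 'v"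
  where "proj n g v = (\<Sum>i<n. ip v (g i) *\<^sub>C g i)"

lemma proj_in: "orthonormal n g \<Longrightarrow> proj n g v \<in> V"
  unfolding proj_def orthonormal_def by (auto intro: sum_in scale_in)

lemma proj_in_span: "proj n g v \<in> cspan (g ` {..<n})"
  unfolding proj_def
  by (intro complex_vector.span_sum complex_vector.span_scale complex_vector.span_base) auto

lemma ip_proj:
  assumes "orthonormal n g" "j < n"
  shows "ip (proj n g v) (g j) = ip v (g j)"
proof -
  have "ip (proj n g v) (g j) = (\<Sum>i<n. ip v (g i) * (if i = j then 1 else 0))"
    using assms unfolding proj_def orthonormal_def by (subst ip_lincomb) auto
  also have "\<dots> = ip v (g j)" using assms(2) by (simp add: if_distrib cong: if_cong)
  finally show ?thesis .
qed

lemma ip_sum_orthonormal: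
  assumes "orthonormal n g" "j < n"
  shows "ip (\<Sum>i<n. c i *\<^sub>C g i) (g j) = c j"
proof -
  have "ip (\<Sum>i<n. c i *\<^sub>C g i) (g j) = (\<Sum>i<n. c i * (if i = j then 1 else 0))"
    using assms unfolding orthonormal_def by (subst ip_lincomb) auto
  also have "\<dots> = c j" using assms(2) by (simp add: if_distrib cong: if_cong)
  finally show ?thesis .
qed

lemma proj_eq:
  assumes "orthonormal n g" "v \<in> cspan (g ` {..<n})"
  shows "proj n g v = v"
proof -
  have "v \<in> V \<and> proj n g v = v"
    using assms(2)
  proof (induction rule: complex_vector.span_induct_alt)
    case base
    show ?case using assms(1) zero_in unfolding orthonormal_def proj_def by (simp add: ip_zero)
  next
    case (step c x y)
    then obtain j where j: "j < n" "x = g j" by auto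
    then have x: "x \<in> V" using assms(1) unfolding orthonormal_def by blast
    have "proj n g x = x"
      using j assms(1) unfolding orthonormal_def proj_def by (simp add: sum_scaleC_delta)
    moreover have "proj n g (c *\<^sub>C x + y) = c *\<^sub>C proj n g x + proj n g y"
      using assms(1) x step unfolding orthonormal_def proj_def
      by (simp add: ip_add ip_scale scale_in scaleC_add_left sum.distrib
          complex_vector.scale_sum_right scaleC_scaleC)
    ultimately show ?case using step x by (simp add: add_in scale_in)
  qed
  then show ?thesis by blast
qed

lemma orthonormal_independent:
  assumes "orthonormal n g"
  shows "inj_on g {..<n}" "complex_vector.independent (g ` {..<n})"
proof -
  show inj: "inj_on g {..<n}"
  proof (rule inj_onI)
    fix i j assume "i \<in> {..<n}" "j \<in> {..<n}" "g i = g j"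
    then show "i = j" using assms unfolding orthonormal_def
      by (metis lessThan_iff zero_neq_one)
  qed
  show "complex_vector.independent (g ` {..<n})"
  proof (rule complex_vector.independent_if_scalars_zero)
    fix f x assume "(\<Sum>x\<in>g ` {..<n}. f x *\<^sub>C x) = 0" "x \<in> g ` {..<n}"
    then obtain j where j: "j < n" "x = g j" and "(\<Sum>i<n. f (g i) *\<^sub>C g i) = 0"
      by (auto simp: sum.reindex[OF inj])
    then show "f x = 0"
      using ip_sum_orthonormal[OF assms j(1), of "\<lambda>i. f (g i)"] assms j
      by (simp add: ip_zero orthonormal_def)
  qed simp
qed

lemma orthonormal_basis_orthonormal: "orthonormal_basis V ip n g \<Longrightarrow> orthonormal n g"
  unfolding orthonormal_def orthonormal_basis_def
  by (auto intro: complex_vector.span_base)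

lemma orthonormal_basis_in: "orthonormal_basis V ip n g \<Longrightarrow> i < n \<Longrightarrow> g i \<in> V"
  using orthonormal_basis_orthonormal orthonormal_def by blast

lemma orthonormal_basis_expand:
  "orthonormal_basis V ip n g \<Longrightarrow> v \<in> V \<Longrightarrow> v = (\<Sum>i<n. ip v (g i) *\<^sub>C g i)"
  using proj_eq[of n g v] orthonormal_basis_orthonormal[of n g]
  by (simp add: orthonormal_basis_def proj_def)

lemma orthonormal_basis_dim: "orthonormal_basis V ip n g \<Longrightarrow> complex_vector.dim V = n"
  using orthonormal_independent[of n g] orthonormal_basis_orthonormal[of n g]
    complex_vector.dim_span_eq_card_independent[of "g ` {..<n}"]
  by (simp add: orthonormal_basis_def card_image)

text \<open>An orthonormal system of maximal length spans: otherwise the normalised residual of a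
  missed vector would prolong it. Since \<open>A\<close> may lie outside \<open>V\<close>,
  generators of a large space serve all its subspaces.\<close>

lemma exists_orthonormal_basis:
  assumes fin: "finite A" "V \<subseteq> cspan A"
  shows "\<exists>n g. orthonormal_basis V ip n g"
proof -
  have bound: "n \<le> card A" if "orthonormal n g" for n g
  proof -
    have "g ` {..<n} \<subseteq> cspan A" using that fin unfolding orthonormal_def by auto
    then have "card (g ` {..<n}) \<le> card A"
      using complex_vector.independent_span_bound[OF fin(1) orthonormal_independent(2)[OF that]] by blast
    then show ?thesis using card_image[OF orthonormal_independent(1)[OF that]] by simp
  qed
  define n where "n = (GREATEST n. \<exists>g. orthonormal n g)"
  have "\<exists>g. orthonormal 0 g" by (simp add: orthonormal_def)
  then have "\<exists>g. orthonormal n g"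
    unfolding n_def using bound by (intro GreatestI_nat[of "\<lambda>n. \<exists>g. orthonormal n g" 0 "card A"]) auto
  then obtain g where g: "orthonormal n g" by blast
  have max: "\<not> orthonormal (Suc n) h" for h
  proof
    assume "orthonormal (Suc n) h"
    then have "Suc n \<le> n"
      unfolding n_def using bound by (intro Greatest_le_nat[of "\<lambda>n. \<exists>g. orthonormal n g" _ "card A"]) auto
    then show False by simp
  qed
  have "v \<in> cspan (g ` {..<n})" if v: "v \<in> V" for v
  proof (rule ccontr)
    assume nv: "v \<notin> cspan (g ` {..<n})"
    define r where "r = v - proj n g v"
    have r: "r \<in> V" using v proj_in[OF g] by (simp add: r_def diff_in)
    have "r \<noteq> 0" using nv proj_in_span[of n g v] by (auto simp: r_def)
    then have pos: "0 < Re (ip r r)" using r by (rule ip_pos[rotated])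
    have real: "ip r r = of_real (Re (ip r r))"
      using ip_cnj[OF r r] by (simp add: complex_eq_iff)
    have orth: "ip r (g j) = 0" if "j < n" for j
      using that g v unfolding r_def by (simp add: ip_diff proj_in ip_proj orthonormal_def)
    then have orth': "ip (g j) r = 0" if "j < n" for j
      using that g r ip_cnj[of r "g j"] by (simp add: orthonormal_def)
    define s where "s = (complex_of_real (1 / sqrt (Re (ip r r)))) *\<^sub>C r"
    have "ip s s = of_real (1 / sqrt (Re (ip r r)) * (1 / sqrt (Re (ip r r))) * Re (ip r r))"
      by (simp only: s_def ip_scale[OF r scale_in[OF r]] ip_scale_right[OF r r] of_real_mult
          complex_cnj_complex_of_real mult.assoc real[symmetric])
    also have "1 / sqrt (Re (ip r r)) * (1 / sqrt (Re (ip r r))) * Re (ip r r) = 1"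
      using pos by (simp add: field_simps)
    finally have ss: "ip s s = 1" by simp
    have s: "s \<in> V" "\<And>j. j < n \<Longrightarrow> ip s (g j) = 0" "\<And>j. j < n \<Longrightarrow> ip (g j) s = 0"
      using r g orth orth' unfolding s_def orthonormal_def
      by (simp_all add: ip_scale ip_scale_right scale_in)
    have "orthonormal (Suc n) (\<lambda>i. if i < n then g i else s)"
      using g s ss unfolding orthonormal_def by auto
    then show False using max by blast
  qed
  moreover have "cspan (g ` {..<n}) \<subseteq> V"
    using g subspace by (intro complex_vector.span_minimal) (auto simp: orthonormal_def)
  ultimately have "orthonormal_basis V ip n g"
    using g unfolding orthonormal_basis_def orthonormal_def by blast
  then show ?thesis by blast
qed

text \<open>The form \<open>ip\<close> is constrained on \<open>V\<close> only, whereas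
  \<open>contract_left\<close> requires a functional linear on the whole type.\<close>

lemma ip_functional:
  assumes "y \<in> V"
  obtains \<phi> where "complex_linear \<phi>" "\<And>v. v \<in> V \<Longrightarrow> \<phi> v = ip v y"
  using complex_linear_extension[OF subspace, of "\<lambda>v. ip v y"] assms
  by (auto simp: ip_add ip_scale scaleC_complex_def)

section \<open>Orthogonal complements\<close>

definition orthogonal_complement :: "'v set \<Rightarrow> 'v set"
  where "orthogonal_complement W = {v \<in> V. \<forall>w\<in>W. ip v w = 0}"

lemma csubspace_orthogonal_complement: "W \<subseteq> V \<Longrightarrow> csubspace (orthogonal_complement W)"
  unfolding complex_vector.subspace_def orthogonal_complement_def
  by (auto simp: zero_in add_in scale_in ip_zero ip_add ip_scale subset_iff)

lemma orthogonal_decomposition: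
  assumes "csubspace W" "W \<subseteq> V" "orthonormal_basis W ip m g" "v \<in> V"
  shows "proj m g v \<in> W" "v - proj m g v \<in> orthogonal_complement W"
proof -
  interpret W: inner_product_subspace W ip
    using assms by (intro inner_product_subspace_subset)
  have g: "orthonormal m g"
    using W.orthonormal_basis_orthonormal[OF assms(3)] assms(2)
    by (auto simp: orthonormal_def W.orthonormal_def)
  show pW: "proj m g v \<in> W" using proj_in_span[of m g v] assms(3) by (simp add: orthonormal_basis_def)
  have r: "v - proj m g v \<in> V" using assms pW by (auto intro: diff_in)
  have "ip (v - proj m g v) w = 0" if w: "w \<in> W" for w
  proof -
    have "ip w (v - proj m g v) = (\<Sum>i<m. ip w (g i) * ip (g i) (v - proj m g v))"
      using g r by (subst W.orthonormal_basis_expand[OF assms(3) w], subst ip_lincomb)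
        (auto simp: orthonormal_def)
    also have "\<dots> = 0"
    proof (rule sum.neutral, rule ballI)
      fix i assume "i \<in> {..<m}"
      then have "g i \<in> V" "ip (v - proj m g v) (g i) = 0"
        using g assms(4) by (simp_all add: ip_diff proj_in ip_proj orthonormal_def)
      then show "ip w (g i) * ip (g i) (v - proj m g v) = 0"
        using ip_cnj[OF r \<open>g i \<in> V\<close>] by simp
    qed
    finally show ?thesis using ip_cnj[OF _ r, of w] w assms(2) by auto
  qed
  then show "v - proj m g v \<in> orthogonal_complement W"
    using r by (simp add: orthogonal_complement_def)
qed

lemma orthonormal_basis_append:
  assumes W: "csubspace W" "W \<subseteq> V"
    and g: "orthonormal_basis W ip m g"
    and h: "orthonormal_basis (orthogonal_complement W) ip m' h"
  shows "orthonormal_basis V ip (m + m') (\<lambda>i. if i < m then g i else h (i - m))"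
proof -
  let ?f = "\<lambda>i. if i < m then g i else h (i - m)"
  interpret W: inner_product_subspace W ip
    using W by (intro inner_product_subspace_subset)
  interpret C: inner_product_subspace "orthogonal_complement W" ip
    by (intro inner_product_subspace_subset csubspace_orthogonal_complement W)
      (auto simp: orthogonal_complement_def)
  have gW: "g i \<in> W" if "i < m" for i using that W.orthonormal_basis_in[OF g] by blast
  have hW: "h i \<in> orthogonal_complement W" if "i < m'" for i
    using that C.orthonormal_basis_in[OF h] by blast
  have gh: "ip (h j) (g i) = 0" "ip (g i) (h j) = 0" if "i < m" "j < m'" for i j
  proof -
    have "g i \<in> V" "h j \<in> V" and *: "ip (h j) (g i) = 0"
      using gW[OF that(1)] hW[OF that(2)] W(2) by (auto simp: orthogonal_complement_def)
    show "ip (h j) (g i) = 0" by (rule *)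
    show "ip (g i) (h j) = 0"
      using ip_cnj[OF \<open>h j \<in> V\<close> \<open>g i \<in> V\<close>] * by simp
  qed
  have f: "?f ` {..<m + m'} = g ` {..<m} \<union> h ` {..<m'}"
  proof (intro equalityI subsetI)
    fix x assume "x \<in> g ` {..<m} \<union> h ` {..<m'}"
    then consider i where "i < m" "x = g i" | i where "i < m'" "x = h i" by auto
    then show "x \<in> ?f ` {..<m + m'}"
    proof cases
      case 1 then show ?thesis by (intro image_eqI[of _ _ i]) auto
    next
      case 2 then show ?thesis by (intro image_eqI[of _ _ "m + i"]) auto
    qed
  qed auto
  have "cspan (?f ` {..<m + m'}) = V"
  proof
    show "cspan (?f ` {..<m + m'}) \<subseteq> V"
      unfolding f using gW hW W(2) subspace
      by (intro complex_vector.span_minimal) (auto simp: orthogonal_complement_def)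
    show "V \<subseteq> cspan (?f ` {..<m + m'})"
    proof
      fix v assume "v \<in> V"
      note * = orthogonal_decomposition[OF W g this]
      have "proj m g v \<in> cspan (?f ` {..<m + m'})" "v - proj m g v \<in> cspan (?f ` {..<m + m'})"
        using * g h complex_vector.span_mono[of "g ` {..<m}" "g ` {..<m} \<union> h ` {..<m'}"]
          complex_vector.span_mono[of "h ` {..<m'}" "g ` {..<m} \<union> h ` {..<m'}"]
        unfolding f orthonormal_basis_def by auto
      from complex_vector.span_add[OF this] show "v \<in> cspan (?f ` {..<m + m'})" by simp
    qed
  qed
  then show ?thesis
    using g h gh unfolding orthonormal_basis_def by auto
qed

end

section \<open>Unitary corepresentations\<close>

lemma contract_left_dual:
  fixes n :: nat
  assumes "complex_linear \<phi>" "i < n" "\<And>k. k < n \<Longrightarrow> \<phi> (e k) = (if i = k then 1 else 0)"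
  shows "contract_left \<phi> (\<Sum>k<n. e k \<otimes> x k) = x i"
proof -
  have "contract_left \<phi> (\<Sum>k<n. e k \<otimes> x k) = (\<Sum>k<n. (if i = k then 1 else 0) *\<^sub>C x k)"
    by (simp add: complex_linear_sum[OF contract_left(1)[OF assms(1)]] contract_left(2)[OF assms(1)] assms(3))
  also have "\<dots> = x i" using assms(2) by (simp add: sum_scaleC_delta)
  finally show ?thesis .
qed

context star_hopf_algebra
begin

lemma comult_linear: "complex_linear \<Delta>"
  using comult_star_hom by (intro complex_linearI) (auto simp: star_hom_on_def)

lemma counit_linear: "complex_linear \<epsilon>"
  using counit_star_hom by (intro complex_linearI) (auto simp: star_hom_on_def)

text \<open>Evaluate coassociativity and the counit axiom at \<open>e j\<close> and compare the
  coefficients of \<open>e i\<close>, which the dual functional \<phi> i isolates.\<close>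

lemma corepresentation_matrix:
  fixes n :: nat and V :: "'v::complex_vector set" and \<phi> :: "nat \<Rightarrow> 'v \<Rightarrow> complex"
  assumes corep: "corepresentation \<Delta> \<epsilon> V \<delta>"
    and e: "\<And>j. j < n \<Longrightarrow> e j \<in> V"
    and u: "\<And>j. j < n \<Longrightarrow> \<delta> (e j) = (\<Sum>i<n. e i \<otimes> u i j)"
    and \<phi>: "\<And>i. i < n \<Longrightarrow> complex_linear (\<phi> i)"
    and dual: "\<And>i j. i < n \<Longrightarrow> j < n \<Longrightarrow> \<phi> i (e j) = (if i = j then 1 else 0)"
    and i: "i < n" and j: "j < n"
  shows "\<Delta> (u i j) = (\<Sum>k<n. u i k \<otimes> u k j)" "\<epsilon> (u i j) = (if i = j then 1 else 0)"
proof -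
  have \<delta>: "complex_linear \<delta>" using corep by (simp add: corepresentation_def)
  have m1: "tensor_map id \<Delta> (\<delta> (e j)) = (\<Sum>k<n. e k \<otimes> \<Delta> (u k j))"
    unfolding u[OF j] complex_linear_sum[OF tensor_map(1)[OF complex_linear_id(1) comult_linear]]
    by (simp add: tensor_map(2) complex_linear_id comult_linear)
  have "tensor_assoc (tensor_map \<delta> id (\<delta> (e j))) = (\<Sum>k<n. tensor_assoc (\<delta> (e k) \<otimes> u k j))"
    unfolding u[OF j] complex_linear_sum[OF tensor_map(1)[OF \<delta> complex_linear_id(1)]]
      complex_linear_sum[OF tensor_assoc(1)]
    by (simp add: tensor_map(2) complex_linear_id \<delta>)
  also have "\<dots> = (\<Sum>k<n. \<Sum>l<n. e l \<otimes> (u l k \<otimes> u k j))"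
    by (simp add: u tensor_sum_left complex_linear_sum[OF tensor_assoc(1)] tensor_assoc(2))
  also have "\<dots> = (\<Sum>l<n. e l \<otimes> (\<Sum>k<n. u l k \<otimes> u k j))"
    unfolding tensor_sum_right by (rule sum.swap)
  finally have m2: "tensor_assoc (tensor_map \<delta> id (\<delta> (e j))) = (\<Sum>l<n. e l \<otimes> (\<Sum>k<n. u l k \<otimes> u k j))" .
  have "(\<Sum>k<n. e k \<otimes> \<Delta> (u k j)) = (\<Sum>l<n. e l \<otimes> (\<Sum>k<n. u l k \<otimes> u k j))"
    unfolding m1[symmetric] m2[symmetric] using corep e[OF j] unfolding corepresentation_def by blast
  from arg_cong[OF this, of "contract_left (\<phi> i)"]
  show "\<Delta> (u i j) = (\<Sum>k<n. u i k \<otimes> u k j)"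
    by (simp add: contract_left_dual[OF \<phi>[OF i] i] dual i)
  have "cbilinear (\<lambda>w h. \<epsilon> h *\<^sub>C w :: 'v)"
    by (simp add: cbilinear_iff complex_linearD[OF counit_linear] scaleC_add_left scaleC_add_right
        scaleC_scaleC scaleC_complex_def mult.commute)
  note lift = tensor_lift[OF this]
  have "tensor_lift (\<lambda>w h. \<epsilon> h *\<^sub>C w) (\<delta> (e j)) = e j"
    using corep e[OF j] unfolding corepresentation_def by blast
  then have "(\<Sum>k<n. \<epsilon> (u k j) *\<^sub>C e k) = e j"
    by (simp add: u[OF j] complex_linear_sum[OF lift(1)] lift(2))
  then have "\<phi> i (\<Sum>k<n. \<epsilon> (u k j) *\<^sub>C e k) = \<phi> i (e j)" by simp
  then have "(\<Sum>k<n. \<epsilon> (u k j) * (if i = k then 1 else 0)) = (if i = j then 1 else 0)"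
    by (simp add: complex_linear_sum[OF \<phi>[OF i]] complex_linearD(2)[OF \<phi>[OF i]] scaleC_complex_def dual i j)
  then show "\<epsilon> (u i j) = (if i = j then 1 else 0)"
    using i by (simp add: if_distrib cong: if_cong)
qed

text \<open>In the matrix ring, S(u) is a left inverse of u by the antipode axiom, and the adjoint
  matrix is a right inverse by unitarity; hence they agree.\<close>

lemma antipode_unitary_matrix:
  fixes n :: nat
  assumes comult: "\<And>i j. i < n \<Longrightarrow> j < n \<Longrightarrow> \<Delta> (u i j) = (\<Sum>k<n. u i k \<otimes> u k j)"
    and counit: "\<And>i j. i < n \<Longrightarrow> j < n \<Longrightarrow> \<epsilon> (u i j) = (if i = j then 1 else 0)"
    and unitary: "\<And>i j. i < n \<Longrightarrow> j < n \<Longrightarrow> (\<Sum>k<n. u i k * star (u j k)) = (if i = j then 1 else 0)"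
    and i: "i < n" and j: "j < n"
  shows "S (u i j) = star (u j i)"
proof -
  have "cbilinear (\<lambda>x y. S x * y)"
    by (simp add: cbilinear_iff complex_linearD[OF antipode_linear] distrib_left distrib_right
        mult_scaleC_left mult_scaleC_right)
  note lift = tensor_lift[OF this]
  have inv: "(\<Sum>k<n. S (u i k) * u k l) = (if i = l then 1 else 0)" if "l < n" for l
  proof -
    have "(\<Sum>k<n. S (u i k) * u k l) = \<epsilon> (u i l) *\<^sub>C 1"
      unfolding antipode_left[of "u i l", symmetric] comult[OF i that]
      by (simp add: complex_linear_sum[OF lift(1)] lift(2))
    then show ?thesis by (simp add: counit[OF i that] scaleC_delta)
  qed
  have "S (u i j) = (\<Sum>k<n. S (u i k) * (if k = j then 1 else 0))"
    using j by (simp add: if_distrib cong: if_cong)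
  also have "\<dots> = (\<Sum>k<n. S (u i k) * (\<Sum>l<n. u k l * star (u j l)))"
    using j by (intro sum.cong refl) (simp add: unitary)
  also have "\<dots> = (\<Sum>k<n. \<Sum>l<n. S (u i k) * u k l * star (u j l))"
    by (simp add: sum_distrib_left mult.assoc)
  also have "\<dots> = (\<Sum>l<n. \<Sum>k<n. S (u i k) * u k l * star (u j l))"
    by (rule sum.swap)
  also have "\<dots> = (\<Sum>l<n. (if i = l then 1 else 0) * star (u j l))"
    by (simp add: inv flip: sum_distrib_right)
  also have "\<dots> = star (u j i)"
    using i by (simp add: if_distrib[of "\<lambda>x. x * _"] cong: if_cong)
  finally show ?thesis .
qed

end

section \<open>Invariant subspaces of unitary corepresentations\<close>

locale unitary_hopf_corepresentation = star_hopf_algebra \<Delta> \<epsilon> S + inner_product_subspace V ip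
  for \<Delta> :: "'h::complex_star_algebra \<Rightarrow> ('h, 'h) tensor"
    and \<epsilon> :: "'h \<Rightarrow> complex"
    and S :: "'h \<Rightarrow> 'h"
    and V :: "'v::complex_vector set"
    and ip :: "'v \<Rightarrow> 'v \<Rightarrow> complex" +
  fixes \<delta> :: "'v \<Rightarrow> ('v, 'h) tensor"
  assumes unitary: "unitary_corepresentation \<Delta> \<epsilon> V ip \<delta>"
begin

lemma corep: "corepresentation \<Delta> \<epsilon> V \<delta>"
  using unitary by (simp add: unitary_corepresentation_def)

lemma coaction_linear: "complex_linear \<delta>"
  using corep by (simp add: corepresentation_def)

lemma finite_span: "\<exists>A. finite A \<and> V = cspan A"
  using unitary by (simp add: unitary_corepresentation_def)

lemma unitary_matrix:
  assumes "orthonormal_basis V ip n e"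
  obtains u where "\<And>j. j < n \<Longrightarrow> \<delta> (e j) = (\<Sum>i<n. e i \<otimes> u i j)"
    "\<And>i j. i < n \<Longrightarrow> j < n \<Longrightarrow> (\<Sum>k<n. star (u k i) * u k j) = (if i = j then 1 else 0)"
    "\<And>i j. i < n \<Longrightarrow> j < n \<Longrightarrow> (\<Sum>k<n. u i k * star (u j k)) = (if i = j then 1 else 0)"
proof -
  from unitary[unfolded unitary_corepresentation_def, THEN conjunct2, THEN conjunct2, THEN conjunct2,
      rule_format, OF assms]
  obtain u where "\<forall>j<n. \<delta> (e j) = (\<Sum>i<n. e i \<otimes> u i j)"
    "\<forall>i<n. \<forall>j<n. (\<Sum>k<n. star (u k i) * u k j) = (if i = j then 1 else 0)"
    "\<forall>i<n. \<forall>j<n. (\<Sum>k<n. u i k * star (u j k)) = (if i = j then 1 else 0)"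
    by (elim exE conjE)
  then show thesis by (intro that[of u]; blast)
qed

lemma coordinate_functionals:
  assumes "orthonormal_basis V ip n e"
  obtains \<phi> where "\<And>i. i < n \<Longrightarrow> complex_linear (\<phi> i)"
    "\<And>i v. i < n \<Longrightarrow> v \<in> V \<Longrightarrow> \<phi> i v = ip v (e i)"
proof -
  have "\<forall>i. \<exists>f. i < n \<longrightarrow> complex_linear f \<and> (\<forall>v\<in>V. f v = ip v (e i))"
    using ip_functional orthonormal_basis_in[OF assms] by metis
  from choice[OF this] show thesis using that by blast
qed

text \<open>The matrix \<open>u\<close> of a corepresentation satisfies \<open>S(u) u = 1\<close>, so unitarity forces
  \<open>S(u) = u\<^sup>*\<close>; hence a block triangular unitary matrix is block diagonal.\<close>

lemma block_diagonal_matrix: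
  assumes W: "csubspace W" "W \<subseteq> V" "\<delta> ` W \<subseteq> tensor_sub W"
    and g: "orthonormal_basis W ip m g"
    and h: "orthonormal_basis (orthogonal_complement W) ip m' h"
  obtains u where "\<And>j. j < m \<Longrightarrow> \<delta> (g j) = (\<Sum>i<m. g i \<otimes> u i j)"
    "\<And>j. j < m' \<Longrightarrow> \<delta> (h j) = (\<Sum>i<m'. h i \<otimes> u (m + i) (m + j))"
    "\<And>i j. i < m \<Longrightarrow> j < m \<Longrightarrow> (\<Sum>k<m. star (u k i) * u k j) = (if i = j then 1 else 0)"
    "\<And>i j. i < m \<Longrightarrow> j < m \<Longrightarrow> (\<Sum>k<m. u i k * star (u j k)) = (if i = j then 1 else 0)"
    "\<And>i j. i < m' \<Longrightarrow> j < m' \<Longrightarrow>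
      (\<Sum>k<m'. star (u (m + k) (m + i)) * u (m + k) (m + j)) = (if i = j then 1 else 0)"
    "\<And>i j. i < m' \<Longrightarrow> j < m' \<Longrightarrow>
      (\<Sum>k<m'. u (m + i) (m + k) * star (u (m + j) (m + k))) = (if i = j then 1 else 0)"
proof -
  define f where "f = (\<lambda>i. if i < m then g i else h (i - m))"
  have fg: "f i = g i" if "i < m" for i using that by (simp add: f_def)
  have fh: "f (m + i) = h i" for i by (simp add: f_def)
  have f: "orthonormal_basis V ip (m + m') f"
    unfolding f_def by (rule orthonormal_basis_append[OF W(1,2) g h])
  obtain u where u: "\<And>j. j < m + m' \<Longrightarrow> \<delta> (f j) = (\<Sum>i<m + m'. f i \<otimes> u i j)"
    "\<And>i j. i < m + m' \<Longrightarrow> j < m + m' \<Longrightarrow>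
      (\<Sum>k<m + m'. star (u k i) * u k j) = (if i = j then 1 else 0)"
    "\<And>i j. i < m + m' \<Longrightarrow> j < m + m' \<Longrightarrow>
      (\<Sum>k<m + m'. u i k * star (u j k)) = (if i = j then 1 else 0)"
    using unitary_matrix[OF f] by blast
  obtain \<phi> where \<phi>: "\<And>i. i < m + m' \<Longrightarrow> complex_linear (\<phi> i)"
    "\<And>i v. i < m + m' \<Longrightarrow> v \<in> V \<Longrightarrow> \<phi> i v = ip v (f i)"
    using coordinate_functionals[OF f] by blast
  have dual: "\<phi> i (f j) = (if i = j then 1 else 0)" if "i < m + m'" "j < m + m'" for i j
    using \<phi>(2)[OF that(1) orthonormal_basis_in[OF f that(2)]] f that
    by (auto simp: orthonormal_basis_def)
  have S: "S (u i j) = star (u j i)" if "i < m + m'" "j < m + m'" for i j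
    by (rule antipode_unitary_matrix[OF _ _ u(3) that])
      (rule corepresentation_matrix[OF corep orthonormal_basis_in[OF f] u(1) \<phi>(1) dual]; assumption)+
  interpret W: inner_product_subspace W ip
    using W by (intro inner_product_subspace_subset)
  have hC: "h i \<in> orthogonal_complement W" if "i < m'" for i
  proof -
    have "h i \<in> cspan (h ` {..<m'})" using that by (intro complex_vector.span_base) simp
    then show ?thesis using h by (simp add: orthonormal_basis_def)
  qed
  \<comment> \<open>Invariance of \<open>W\<close> kills this block: the functional dual to
    \<open>h i\<close> vanishes on \<open>W\<close>, while \<delta> (g j) has all its left factors
    there.\<close>
  have lower: "u (m + i) j = 0" if "i < m'" "j < m" for i j
  proof -
    have "\<phi> (m + i) w = 0" if w: "w \<in> W" for w
    proof -
      have "h i \<in> V" "ip (h i) w = 0" "w \<in> V"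
        using hC[OF \<open>i < m'\<close>] w W(2) by (auto simp: orthogonal_complement_def)
      then have "ip w (h i) = 0" using ip_cnj[of "h i" w] by simp
      then show ?thesis using \<phi>(2)[of "m + i" w] \<open>i < m'\<close> \<open>w \<in> V\<close> by (simp add: fh)
    qed
    moreover have "\<delta> (f j) \<in> tensor_sub W"
      using W(3) W.orthonormal_basis_in[OF g that(2)] by (auto simp: fg that)
    ultimately have "contract_left (\<phi> (m + i)) (\<delta> (f j)) = 0"
      using that by (intro contract_left_tensor_sub[OF \<phi>(1)]) auto
    moreover have "contract_left (\<phi> (m + i)) (\<Sum>k<m + m'. f k \<otimes> u k j) = u (m + i) j"
      using that by (intro contract_left_dual[where x = "\<lambda>k. u k j"] \<phi>(1) dual) auto
    ultimately show ?thesis using that by (simp add: u(1))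
  qed
  \<comment> \<open>The adjoint of this entry is the antipode of an entry in the vanishing lower
    block.\<close>
  have upper: "u j (m + i) = 0" if "i < m'" "j < m" for i j
  proof -
    have "star (u j (m + i)) = S 0"
      using S[of "m + i" j] lower[OF that] that by simp
    then have "star (star (u j (m + i))) = 0"
      using complex_vector.linear_0[OF antipode_linear] by simp
    then show ?thesis by (simp add: star_star)
  qed
  show thesis
  proof (rule that[of u])
    show "\<delta> (g j) = (\<Sum>i<m. g i \<otimes> u i j)" if "j < m" for j
      using u(1)[of j] that by (simp add: sum_lessThan_add fg fh lower)
    show "\<delta> (h j) = (\<Sum>i<m'. h i \<otimes> u (m + i) (m + j))" if "j < m'" for j
      using u(1)[of "m + j"] that by (simp add: sum_lessThan_add fg fh upper)
    show "(\<Sum>k<m. star (u k i) * u k j) = (if i = j then 1 else 0)" if "i < m" "j < m" for i j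
      using u(2)[of i j] that by (simp add: sum_lessThan_add lower)
    show "(\<Sum>k<m. u i k * star (u j k)) = (if i = j then 1 else 0)" if "i < m" "j < m" for i j
      using u(3)[of i j] that by (simp add: sum_lessThan_add upper)
    show "(\<Sum>k<m'. star (u (m + k) (m + i)) * u (m + k) (m + j)) = (if i = j then 1 else 0)"
      if "i < m'" "j < m'" for i j
      using u(2)[of "m + i" "m + j"] that by (simp add: sum_lessThan_add upper)
    show "(\<Sum>k<m'. u (m + i) (m + k) * star (u (m + j) (m + k))) = (if i = j then 1 else 0)"
      if "i < m'" "j < m'" for i j
      using u(3)[of "m + i" "m + j"] that by (simp add: sum_lessThan_add lower)
  qed
qed

lemma subspace_unitary_corepresentation:
  assumes W: "csubspace W" "W \<subseteq> V" and inv: "\<delta> ` W \<subseteq> tensor_sub W"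
    and matrix: "\<And>m g. orthonormal_basis W ip m g \<Longrightarrow>
      \<exists>u. (\<forall>j<m. \<delta> (g j) = (\<Sum>i<m. g i \<otimes> u i j)) \<and>
        (\<forall>i<m. \<forall>j<m. (\<Sum>k<m. star (u k i) * u k j) = (if i = j then 1 else 0)) \<and>
        (\<forall>i<m. \<forall>j<m. (\<Sum>k<m. u i k * star (u j k)) = (if i = j then 1 else 0))"
    and basis: "orthonormal_basis W ip n f"
  shows "unitary_corepresentation \<Delta> \<epsilon> W ip \<delta>"
proof -
  interpret W: inner_product_subspace W ip
    using W by (intro inner_product_subspace_subset)
  have "corepresentation \<Delta> \<epsilon> W \<delta>"
    using corep W inv unfolding corepresentation_def by blast
  moreover have "finite (f ` {..<n})" "W = cspan (f ` {..<n})"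
    using basis by (simp_all add: orthonormal_basis_def)
  ultimately show ?thesis
    unfolding unitary_corepresentation_def
    by (intro conjI exI[of _ "f ` {..<n}"] allI impI matrix W.ip)
qed

text \<open>Unitarity quantifies over all orthonormal bases, so the block form is taken afresh for
  each basis of one summand, completed by a fixed basis of the other.\<close>

lemma unitary_corepresentation_split:
  assumes W: "csubspace W" "W \<subseteq> V" and inv: "\<delta> ` W \<subseteq> tensor_sub W"
  shows "unitary_corepresentation \<Delta> \<epsilon> W ip \<delta>"
    "unitary_corepresentation \<Delta> \<epsilon> (orthogonal_complement W) ip \<delta>"
proof -
  let ?C = "orthogonal_complement W"
  have C: "csubspace ?C" "?C \<subseteq> V"
    using csubspace_orthogonal_complement[OF W(2)] by (auto simp: orthogonal_complement_def)
  interpret W: inner_product_subspace W ip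
    using W by (intro inner_product_subspace_subset)
  interpret C: inner_product_subspace ?C ip
    using C by (intro inner_product_subspace_subset)
  obtain A where "finite A" "V = cspan A" using finite_span by blast
  then obtain m g m' h where g: "orthonormal_basis W ip m g" and h: "orthonormal_basis ?C ip m' h"
    using W.exists_orthonormal_basis[of A] C.exists_orthonormal_basis[of A] W C by blast
  show "unitary_corepresentation \<Delta> \<epsilon> W ip \<delta>"
  proof (rule subspace_unitary_corepresentation[OF W inv _ g])
    fix k f assume fb: "orthonormal_basis W ip k f"
    show "\<exists>u. (\<forall>j<k. \<delta> (f j) = (\<Sum>i<k. f i \<otimes> u i j)) \<and>
        (\<forall>i<k. \<forall>j<k. (\<Sum>l<k. star (u l i) * u l j) = (if i = j then 1 else 0)) \<and>
        (\<forall>i<k. \<forall>j<k. (\<Sum>l<k. u i l * star (u j l)) = (if i = j then 1 else 0))"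
    proof (rule block_diagonal_matrix[OF W inv fb h])
      fix u assume
      "\<And>j. j < k \<Longrightarrow> \<delta> (f j) = (\<Sum>i<k. f i \<otimes> u i j)"
      "\<And>i j. i < k \<Longrightarrow> j < k \<Longrightarrow> (\<Sum>l<k. star (u l i) * u l j) = (if i = j then 1 else 0)"
      "\<And>i j. i < k \<Longrightarrow> j < k \<Longrightarrow> (\<Sum>l<k. u i l * star (u j l)) = (if i = j then 1 else 0)"
      then show ?thesis by (intro exI[of _ "u"]) simp
    qed
  qed
  have "\<delta> v \<in> tensor_sub ?C" if v: "v \<in> ?C" for v
  proof -
    obtain u where u: "\<And>j. j < m' \<Longrightarrow> \<delta> (h j) = (\<Sum>i<m'. h i \<otimes> u (m + i) (m + j))"
      using block_diagonal_matrix[OF W inv g h] by metis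
    have "\<delta> (h j) \<in> tensor_sub ?C" if "j < m'" for j
      unfolding u[OF that] using C.orthonormal_basis_in[OF h]
      by (intro complex_vector.subspace_sum[OF csubspace_tensor_sub] tensor_sub_tensor) simp
    then have "(\<Sum>j<m'. ip v (h j) *\<^sub>C \<delta> (h j)) \<in> tensor_sub ?C"
      by (intro complex_vector.subspace_sum[OF csubspace_tensor_sub]
          complex_vector.subspace_scale[OF csubspace_tensor_sub]) simp
    then show ?thesis
      by (subst C.orthonormal_basis_expand[OF h v])
        (simp add: complex_linear_sum[OF coaction_linear] complex_linearD(2)[OF coaction_linear])
  qed
  then have "\<delta> ` ?C \<subseteq> tensor_sub ?C" by blast
  then show "unitary_corepresentation \<Delta> \<epsilon> ?C ip \<delta>"
  proof (rule subspace_unitary_corepresentation[OF C _ _ h])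
    fix k f assume fb: "orthonormal_basis ?C ip k f"
    show "\<exists>u. (\<forall>j<k. \<delta> (f j) = (\<Sum>i<k. f i \<otimes> u i j)) \<and>
        (\<forall>i<k. \<forall>j<k. (\<Sum>l<k. star (u l i) * u l j) = (if i = j then 1 else 0)) \<and>
        (\<forall>i<k. \<forall>j<k. (\<Sum>l<k. u i l * star (u j l)) = (if i = j then 1 else 0))"
    proof (rule block_diagonal_matrix[OF W inv g fb])
      fix u assume
      "\<And>j. j < k \<Longrightarrow> \<delta> (f j) = (\<Sum>i<k. f i \<otimes> u (m + i) (m + j))"
      "\<And>i j. i < k \<Longrightarrow> j < k \<Longrightarrow>
        (\<Sum>l<k. star (u (m + l) (m + i)) * u (m + l) (m + j)) = (if i = j then 1 else 0)"
      "\<And>i j. i < k \<Longrightarrow> j < k \<Longrightarrow>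
        (\<Sum>l<k. u (m + i) (m + l) * star (u (m + j) (m + l))) = (if i = j then 1 else 0)"
      then show ?thesis by (intro exI[of _ "\<lambda>i j. u (m + i) (m + j)"]) simp
    qed
  qed
qed

end

lemma (in star_hopf_algebra) unitary_hopf_corepresentationI:
  assumes "unitary_corepresentation \<Delta> \<epsilon> V ip \<delta>"
  shows "unitary_hopf_corepresentation \<Delta> \<epsilon> S V ip \<delta>"
  by unfold_locales (use assms in \<open>auto simp: unitary_corepresentation_def corepresentation_def\<close>)

section \<open>Frames of morphisms\<close>

lemma Mor_zero_off: "T \<in> Mor V \<delta> W \<delta>W \<Longrightarrow> v \<notin> V \<Longrightarrow> T v = 0"
  by (simp add: Mor_def)

lemma Mor_extension:
  assumes "T \<in> Mor V \<delta> W \<delta>W"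
  obtains T' where "complex_linear T'" "\<And>v. v \<in> V \<Longrightarrow> T' v = T v"
    "\<And>v. v \<in> V \<Longrightarrow> tensor_map T' id (\<delta> v) = \<delta>W (T v)"
  using assms unfolding Mor_def by blast

lemma Mor_lincomb:
  assumes "T \<in> Mor V \<delta> W \<delta>W" "csubspace V" "\<And>i. i \<in> I \<Longrightarrow> f i \<in> V"
  shows "T (\<Sum>i\<in>I. c i *\<^sub>C f i) = (\<Sum>i\<in>I. c i *\<^sub>C T (f i))"
proof -
  obtain T' where T': "complex_linear T'" "\<And>v. v \<in> V \<Longrightarrow> T' v = T v"
    using Mor_extension[OF assms(1)] by metis
  have "(\<Sum>i\<in>I. c i *\<^sub>C f i) \<in> V"
    using assms by (intro complex_vector.subspace_sum complex_vector.subspace_scale)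
  then have "T (\<Sum>i\<in>I. c i *\<^sub>C f i) = T' (\<Sum>i\<in>I. c i *\<^sub>C f i)" by (simp add: T'(2))
  also have "\<dots> = (\<Sum>i\<in>I. c i *\<^sub>C T (f i))"
    unfolding complex_linear_sum[OF T'(1)]
    by (intro sum.cong refl) (simp add: complex_linearD(2)[OF T'(1)] T'(2) assms(3))
  finally show ?thesis .
qed

text \<open>Extension by zero along an invariant complement: \<pi> projects onto \<open>W\<close>
  along \<open>C\<close>, and equivariance survives because \<delta> preserves both summands. The
  roles of \<open>W\<close> and its complement can be interchanged.\<close>

lemma Mor_compose_projection:
  fixes \<delta> :: "'v::complex_vector \<Rightarrow> ('v, 'h::complex_vector) tensor"
    and T :: "'v \<Rightarrow> 'p::complex_vector"
  assumes T: "T \<in> Mor W \<delta> UNIV \<delta>P" and \<pi>: "complex_linear \<pi>"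
    and W: "\<And>w. w \<in> W \<Longrightarrow> \<pi> w = w" "\<delta> ` W \<subseteq> tensor_sub W"
    and C: "\<And>w. w \<in> C \<Longrightarrow> \<pi> w = 0" "\<delta> ` C \<subseteq> tensor_sub C"
    and V: "\<And>v. v \<in> V \<Longrightarrow> \<exists>w\<in>W. \<exists>c\<in>C. v = w + c"
    and lin: "complex_linear \<delta>"
  shows "(\<lambda>v. if v \<in> V then T (\<pi> v) else 0) \<in> Mor V \<delta> UNIV \<delta>P"
proof -
  obtain T' where T': "complex_linear T'" "\<And>v. v \<in> W \<Longrightarrow> T' v = T v"
    "\<And>v. v \<in> W \<Longrightarrow> tensor_map T' id (\<delta> v) = \<delta>P (T v)"
    using Mor_extension[OF T] by blast
  have zero: "complex_linear (\<lambda>_ :: 'v. 0 :: 'p)" by (rule complex_linearI) simp_all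
  have T\<pi>: "complex_linear (\<lambda>v. T' (\<pi> v))"
    by (rule complex_linearI) (simp_all add: complex_linearD[OF \<pi>] complex_linearD[OF T'(1)])
  have "T' (\<pi> v) = T (\<pi> v) \<and> tensor_map (\<lambda>v. T' (\<pi> v)) id (\<delta> v) = \<delta>P (T (\<pi> v))"
    if v: "v \<in> V" for v
  proof -
    obtain w c where w: "w \<in> W" and c: "c \<in> C" and vwc: "v = w + c" using V[OF v] by blast
    have \<pi>v: "\<pi> v = w" by (simp add: vwc complex_linearD(1)[OF \<pi>] W C w c)
    have "tensor_map (\<lambda>v. T' (\<pi> v)) id (\<delta> w) = tensor_map T' id (\<delta> w)"
      using W w by (intro tensor_map_eq_on_tensor_sub[OF T\<pi> T'(1), of W]) auto
    moreover have "tensor_map (\<lambda>v. T' (\<pi> v)) id (\<delta> c) = tensor_map (\<lambda>_. 0) id (\<delta> c)"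
      using C c complex_vector.linear_0[OF T'(1)]
      by (intro tensor_map_eq_on_tensor_sub[OF T\<pi> zero, of C]) auto
    moreover have "tensor_map (\<lambda>_. 0 :: 'p) id t = 0" for t :: "('v, 'h) tensor"
      by (induction t)
        (simp_all only: tensor_map(2)[OF zero complex_linear_id(1)] tensor_zero_left add_0
          complex_linearD(1)[OF tensor_map(1)[OF zero complex_linear_id(1)]])
    ultimately have "tensor_map (\<lambda>v. T' (\<pi> v)) id (\<delta> v) = tensor_map T' id (\<delta> w)"
      by (simp add: vwc complex_linearD(1)[OF lin]
          complex_linearD(1)[OF tensor_map(1)[OF T\<pi> complex_linear_id(1)]])
    then show ?thesis using T'(2,3)[OF w] by (simp add: \<pi>v)
  qed
  then show ?thesis
    unfolding Mor_def using T\<pi> by (auto intro!: exI[of _ "\<lambda>v. T' (\<pi> v)"])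
qed

text \<open>The condition on the \<open>T\<^sub>k\<close>, stated without a basis of \<open>V\<close>; \<open>ip\<close> is linear in its first argument.\<close>

definition morphism_frame ::
    "'v::complex_vector set \<Rightarrow> ('v \<Rightarrow> 'v \<Rightarrow> complex) \<Rightarrow> ('v \<Rightarrow> ('v, 'h::complex_vector) tensor) \<Rightarrow>
      ('p::complex_star_algebra \<Rightarrow> ('p, 'h) tensor) \<Rightarrow> nat \<Rightarrow> (nat \<Rightarrow> 'v \<Rightarrow> 'p) \<Rightarrow> bool"
  where "morphism_frame V ip \<delta> \<delta>P d T \<longleftrightarrow> (\<forall>k<d. T k \<in> Mor V \<delta> UNIV \<delta>P) \<and>
    (\<forall>v\<in>V. \<forall>w\<in>V. (\<Sum>k<d. star (T k v) * T k w) = ip w v *\<^sub>C 1)"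

text \<open>Expand both arguments in the basis. The adjoint makes the sum antilinear in
  \<open>v\<close>, hence the order \<open>ip w v\<close>. The basis-free form can be evaluated at
  components of vectors in a direct sum.\<close>

lemma (in inner_product_subspace) morphism_frameI:
  assumes e: "orthonormal_basis V ip n e"
    and T: "\<And>k. k < d \<Longrightarrow> T k \<in> Mor V \<delta> UNIV \<delta>P"
    and frame: "\<And>i j. i < n \<Longrightarrow> j < n \<Longrightarrow>
      (\<Sum>k<d. star (T k (e i)) * T k (e j)) = (if i = j then 1 else 0)"
  shows "morphism_frame V ip \<delta> \<delta>P d T"
  unfolding morphism_frame_def
proof (intro conjI ballI allI impI)
  fix v w assume v: "v \<in> V" and w: "w \<in> V"
  have T_eq: "T k x = (\<Sum>i<n. ip x (e i) *\<^sub>C T k (e i))" if "k < d" "x \<in> V" for k x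
  proof -
    have "T k (\<Sum>i<n. ip x (e i) *\<^sub>C e i) = (\<Sum>i<n. ip x (e i) *\<^sub>C T k (e i))"
      using orthonormal_basis_in[OF e] by (intro Mor_lincomb[OF T[OF that(1)] subspace]) auto
    then show ?thesis by (simp flip: orthonormal_basis_expand[OF e that(2)])
  qed
  have "(\<Sum>k<d. star (T k v) * T k w) =
      (\<Sum>k<d. \<Sum>i<n. \<Sum>j<n. (cnj (ip v (e i)) * ip w (e j)) *\<^sub>C (star (T k (e i)) * T k (e j)))"
  proof (rule sum.cong[OF refl])
    fix k assume "k \<in> {..<d}"
    then have k: "k < d" by simp
    show "star (T k v) * T k w =
        (\<Sum>i<n. \<Sum>j<n. (cnj (ip v (e i)) * ip w (e j)) *\<^sub>C (star (T k (e i)) * T k (e j)))"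
      by (subst (1) T_eq[OF k v], subst (1) T_eq[OF k w])
        (simp add: star_sum star_scaleC sum_product mult_scaleC_left mult_scaleC_right scaleC_scaleC
          mult.commute)
  qed
  also have "\<dots> = (\<Sum>i<n. \<Sum>j<n. (cnj (ip v (e i)) * ip w (e j)) *\<^sub>C
      (\<Sum>k<d. star (T k (e i)) * T k (e j)))"
    unfolding complex_vector.scale_sum_right
    by (rule trans[OF sum.swap], rule sum.cong[OF refl], rule sum.swap)
  also have "\<dots> = (\<Sum>i<n. \<Sum>j<n. if i = j then (cnj (ip v (e i)) * ip w (e j)) *\<^sub>C 1 else 0)"
    by (intro sum.cong refl) (simp add: frame)
  also have "\<dots> = (\<Sum>i<n. ip w (e i) * cnj (ip v (e i))) *\<^sub>C 1"
    by (simp add: mult.commute flip: complex_vector.scale_sum_left)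
  also have "(\<Sum>i<n. ip w (e i) * cnj (ip v (e i))) = ip w v"
  proof -
    have "ip (\<Sum>i<n. ip w (e i) *\<^sub>C e i) v = (\<Sum>i<n. ip w (e i) * ip (e i) v)"
      using orthonormal_basis_in[OF e] v by (intro ip_lincomb)
    also have "\<dots> = (\<Sum>i<n. ip w (e i) * cnj (ip v (e i)))"
      using orthonormal_basis_in[OF e] v by (intro sum.cong refl) (simp add: ip_cnj[of v])
    finally show ?thesis by (simp flip: orthonormal_basis_expand[OF e w])
  qed
  finally show "(\<Sum>k<d. star (T k v) * T k w) = ip w v *\<^sub>C 1" .
qed (rule T)

context unitary_hopf_corepresentation
begin

lemma morphism_frame_split:
  assumes W: "csubspace W" "W \<subseteq> V" "\<delta> ` W \<subseteq> tensor_sub W"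
    and g: "orthonormal_basis W ip m g"
    and T: "morphism_frame W ip \<delta> \<delta>P d T"
    and T': "morphism_frame (orthogonal_complement W) ip \<delta> \<delta>P d' T'"
  shows "\<exists>d T. morphism_frame V ip \<delta> \<delta>P d T"
proof -
  let ?C = "orthogonal_complement W"
  have C: "csubspace ?C" "?C \<subseteq> V"
    using csubspace_orthogonal_complement[OF W(2)] by (auto simp: orthogonal_complement_def)
  have inv: "\<delta> ` ?C \<subseteq> tensor_sub ?C"
    using unitary_corepresentation_split(2)[OF W]
    by (simp add: unitary_corepresentation_def corepresentation_def)
  interpret W: inner_product_subspace W ip
    using W by (intro inner_product_subspace_subset)
  \<comment> \<open>The map \<open>proj m g\<close> is known to be linear on \<open>V\<close> only,
    so it is replaced by a linear map of the whole type.\<close>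
  obtain \<pi> where \<pi>: "complex_linear \<pi>" "\<And>v. v \<in> V \<Longrightarrow> \<pi> v = proj m g v"
  proof (rule complex_linear_extension[OF subspace, of "proj m g"])
    fix x y c assume "x \<in> V" "y \<in> V"
    then show "proj m g (x + y) = proj m g x + proj m g y"
      using W.orthonormal_basis_in[OF g] W(2)
      by (simp add: proj_def ip_add subset_iff scaleC_add_left sum.distrib)
  next
    fix c x assume "x \<in> V"
    then show "proj m g (c *\<^sub>C x) = c *\<^sub>C proj m g x"
      using W.orthonormal_basis_in[OF g] W(2)
      by (simp add: proj_def ip_scale subset_iff complex_vector.scale_sum_right scaleC_scaleC)
  qed (rule that)
  have dec: "\<pi> v \<in> W" "v - \<pi> v \<in> ?C" if "v \<in> V" for v
    using orthogonal_decomposition[OF W(1,2) g that] \<pi>(2)[OF that] by simp_all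
  have orth: "ip c w = 0" "ip w c = 0" if "c \<in> ?C" "w \<in> W" for c w
  proof -
    have c: "c \<in> V" and w: "w \<in> V" and 0: "ip c w = 0"
      using that W(2) by (auto simp: orthogonal_complement_def)
    show "ip c w = 0" by (rule 0)
    show "ip w c = 0" using ip_cnj[OF c w] 0 by simp
  qed
  have disjoint: "x = 0" if "x \<in> W" "x \<in> ?C" for x
    using ip_pos[of x] orth(1)[OF that(2,1)] that W(2) by fastforce
  have \<pi>W: "\<pi> w = w" if w: "w \<in> W" for w
  proof -
    have "w - \<pi> w \<in> W" using dec(1)[of w] w W by (auto intro: W.diff_in)
    then show ?thesis using disjoint[of "w - \<pi> w"] dec(2)[of w] w W(2) by auto
  qed
  have \<pi>C: "\<pi> c = 0" if c: "c \<in> ?C" for c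
  proof -
    have "c - (c - \<pi> c) \<in> ?C"
      using dec(2)[of c] c C(2) by (blast intro: complex_vector.subspace_diff[OF C(1) c])
    then show ?thesis using disjoint[of "\<pi> c"] dec(1)[of c] c C(2) by auto
  qed
  have \<pi>': "complex_linear (\<lambda>v. v - \<pi> v)"
    by (rule complex_linearI)
      (simp_all add: complex_linearD[OF \<pi>(1)] complex_vector.scale_right_diff_distrib)
  let ?T = "\<lambda>k v. if v \<in> V then T k (\<pi> v) else 0"
  let ?T' = "\<lambda>k v. if v \<in> V then T' k (v - \<pi> v) else 0"
  have mor: "?T k \<in> Mor V \<delta> UNIV \<delta>P" if "k < d" for k
  proof (rule Mor_compose_projection[OF _ \<pi>(1) \<pi>W W(3) \<pi>C inv _ coaction_linear])
    show "T k \<in> Mor W \<delta> UNIV \<delta>P" using T that by (simp add: morphism_frame_def)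
    show "\<exists>w\<in>W. \<exists>c\<in>?C. v = w + c" if "v \<in> V" for v
      using dec[OF that] by (intro bexI[of _ "\<pi> v"] bexI[of _ "v - \<pi> v"]) auto
  qed
  have mor': "?T' k \<in> Mor V \<delta> UNIV \<delta>P" if "k < d'" for k
  proof (rule Mor_compose_projection[OF _ \<pi>' _ inv _ W(3) _ coaction_linear])
    show "T' k \<in> Mor ?C \<delta> UNIV \<delta>P" using T' that by (simp add: morphism_frame_def)
    show "\<exists>w\<in>?C. \<exists>c\<in>W. v = w + c" if "v \<in> V" for v
      using dec[OF that] by (intro bexI[of _ "\<pi> v"] bexI[of _ "v - \<pi> v"]) auto
  qed (simp_all add: \<pi>W \<pi>C)
  have "morphism_frame V ip \<delta> \<delta>P (d + d') (\<lambda>k. if k < d then ?T k else ?T' (k - d))"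
    unfolding morphism_frame_def
  proof (intro conjI ballI allI impI)
    show "(if k < d then ?T k else ?T' (k - d)) \<in> Mor V \<delta> UNIV \<delta>P" if "k < d + d'" for k
    proof (cases "k < d")
      case True
      then show ?thesis using mor by (simp only: if_True)
    next
      case False
      then have "k - d < d'" using that by simp
      then show ?thesis using mor' False by (simp only: if_False)
    qed
    fix v w assume v: "v \<in> V" and w: "w \<in> V"
    \<comment> \<open>The mixed terms vanish by orthogonality, so the frame identities of the two
      summands add up.\<close>
    have "ip w v = ip (\<pi> w) (\<pi> v) + ip (w - \<pi> w) (v - \<pi> v)"
    proof -
      have *: "\<pi> x \<in> V" "x - \<pi> x \<in> V" if "x \<in> V" for x
        using dec[OF that] W(2) C(2) by auto
      have "ip (\<pi> w + (w - \<pi> w)) (\<pi> v + (v - \<pi> v)) = ip (\<pi> w) (\<pi> v) + ip (w - \<pi> w) (v - \<pi> v)"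
        by (simp only: ip_add[OF *[OF w] add_in[OF *[OF v]]] ip_add_right[OF *(1)[OF w] *[OF v]]
            ip_add_right[OF *(2)[OF w] *[OF v]] orth[OF dec(2)[OF v] dec(1)[OF w]]
            orth[OF dec(2)[OF w] dec(1)[OF v]] add_0 add_0_right)
      then show ?thesis by simp
    qed
    moreover have "(\<Sum>k<d. star (T k (\<pi> v)) * T k (\<pi> w)) = ip (\<pi> w) (\<pi> v) *\<^sub>C 1"
      using T dec v w unfolding morphism_frame_def by blast
    moreover have "(\<Sum>k<d'. star (T' k (v - \<pi> v)) * T' k (w - \<pi> w)) = ip (w - \<pi> w) (v - \<pi> v) *\<^sub>C 1"
      using T' dec v w unfolding morphism_frame_def by blast
    ultimately show "(\<Sum>k<d + d'. star ((if k < d then ?T k else ?T' (k - d)) v) *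
        (if k < d then ?T k else ?T' (k - d)) w) = ip w v *\<^sub>C 1"
      by (simp add: sum_lessThan_add v w scaleC_add_left)
  qed
  then show ?thesis by blast
qed

end

text \<open>Complete reducibility by induction on the dimension: a proper nonzero invariant subspace
  and its orthogonal complement are both unitary and of smaller dimension.\<close>

lemma (in star_hopf_algebra) exists_morphism_frame:
  assumes irreducible: "\<And>W. unitary_corepresentation \<Delta> \<epsilon> W ip \<delta> \<Longrightarrow>
      irreducible_corepresentation W \<delta> \<Longrightarrow> \<exists>d T. morphism_frame W ip \<delta> \<delta>P d T"
    and V: "unitary_corepresentation \<Delta> \<epsilon> V ip \<delta>"
  shows "\<exists>d T. morphism_frame V ip \<delta> \<delta>P d T"
  using V
proof (induction "complex_vector.dim V" arbitrary: V rule: less_induct)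
  case less
  interpret unitary_hopf_corepresentation \<Delta> \<epsilon> S V ip \<delta>
    by (rule unitary_hopf_corepresentationI[OF less.prems])
  consider "V = {0}" | "irreducible_corepresentation V \<delta>" |
    W where "csubspace W" "W \<subseteq> V" "\<delta> ` W \<subseteq> tensor_sub W" "W \<noteq> {0}" "W \<noteq> V"
    unfolding irreducible_corepresentation_def by blast
  then show ?case
  proof cases
    case 1
    \<comment> \<open>Irreducibility excludes the zero space; there the empty frame works, both
      sides of its identity being 0.\<close>
    then have "morphism_frame V ip \<delta> \<delta>P 0 (\<lambda>_ _. 0)"
      using ip_zero[OF zero_in] by (simp add: morphism_frame_def)
    then show ?thesis by blast
  next
    case 2
    then show ?thesis by (rule irreducible[OF less.prems])
  next
    case 3
    let ?C = "orthogonal_complement W"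
    have C: "csubspace ?C" "?C \<subseteq> V"
      using csubspace_orthogonal_complement[OF 3(2)] by (auto simp: orthogonal_complement_def)
    interpret W: inner_product_subspace W ip
      using 3 by (intro inner_product_subspace_subset)
    interpret C: inner_product_subspace ?C ip
      using C by (intro inner_product_subspace_subset)
    obtain A where "finite A" "V = cspan A" using finite_span by blast
    then obtain m g m' h where g: "orthonormal_basis W ip m g" and h: "orthonormal_basis ?C ip m' h"
      using W.exists_orthonormal_basis[of A] C.exists_orthonormal_basis[of A] 3(2) C by blast
    note dim = W.orthonormal_basis_dim[OF g] C.orthonormal_basis_dim[OF h]
      orthonormal_basis_dim[OF orthonormal_basis_append[OF 3(1,2) g h]]
    have "m \<noteq> 0" using g 3(4) by (auto simp: orthonormal_basis_def)
    moreover have "m' \<noteq> 0"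
    proof
      assume "m' = 0"
      then have "?C = {0}" using h by (auto simp: orthonormal_basis_def)
      then have "V \<subseteq> W" using orthogonal_decomposition[OF 3(1,2) g] by fastforce
      then show False using 3(2,5) by blast
    qed
    ultimately have "complex_vector.dim W < complex_vector.dim V"
      "complex_vector.dim ?C < complex_vector.dim V"
      using dim by simp_all
    then obtain d T d' T' where "morphism_frame W ip \<delta> \<delta>P d T" "morphism_frame ?C ip \<delta> \<delta>P d' T'"
      using less.hyps unitary_corepresentation_split[OF 3(1-3)] by meson
    then show ?thesis by (rule morphism_frame_split[OF 3(1-3) g])
  qed
qed

section \<open>The associated left bundle\<close>

text \<open>Trades the existential extension in \<open>Mor\<close> for equations at basis vectors,
  so that closure properties of sections become computations with the matrix
  \<open>u\<close>.\<close>

lemma (in inner_product_subspace) Mor_iff_matrix: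
  assumes e: "orthonormal_basis V ip n e"
    and \<delta>: "complex_linear \<delta>" and \<delta>P: "complex_linear \<delta>P"
    and u: "\<And>j. j < n \<Longrightarrow> \<delta> (e j) = (\<Sum>i<n. e i \<otimes> u i j)"
  shows "T \<in> Mor V \<delta> UNIV \<delta>P \<longleftrightarrow> (\<forall>v. v \<notin> V \<longrightarrow> T v = 0) \<and>
    (\<forall>v\<in>V. T v = (\<Sum>i<n. ip v (e i) *\<^sub>C T (e i))) \<and>
    (\<forall>j<n. \<delta>P (T (e j)) = (\<Sum>i<n. T (e i) \<otimes> u i j))"
proof
  assume T: "T \<in> Mor V \<delta> UNIV \<delta>P"
  obtain T' where T': "complex_linear T'" "\<And>v. v \<in> V \<Longrightarrow> T' v = T v"
    "\<And>v. v \<in> V \<Longrightarrow> tensor_map T' id (\<delta> v) = \<delta>P (T v)"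
    using Mor_extension[OF T] by blast
  note T'_id = tensor_map[OF T'(1) complex_linear_id(1)]
  have "T v = (\<Sum>i<n. ip v (e i) *\<^sub>C T (e i))" if "v \<in> V" for v
  proof -
    have "T (\<Sum>i<n. ip v (e i) *\<^sub>C e i) = (\<Sum>i<n. ip v (e i) *\<^sub>C T (e i))"
      using orthonormal_basis_in[OF e] by (intro Mor_lincomb[OF T subspace]) auto
    then show ?thesis by (simp flip: orthonormal_basis_expand[OF e that])
  qed
  moreover have "\<delta>P (T (e j)) = (\<Sum>i<n. T (e i) \<otimes> u i j)" if j: "j < n" for j
  proof -
    have "\<delta>P (T (e j)) = tensor_map T' id (\<Sum>i<n. e i \<otimes> u i j)"
      using T'(3)[OF orthonormal_basis_in[OF e j]] by (simp only: u[OF j])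
    also have "\<dots> = (\<Sum>i<n. T' (e i) \<otimes> u i j)"
      by (simp only: complex_linear_sum[OF T'_id(1)] T'_id(2) id_apply)
    also have "\<dots> = (\<Sum>i<n. T (e i) \<otimes> u i j)"
      using orthonormal_basis_in[OF e] by (intro sum.cong refl) (simp add: T'(2))
    finally show ?thesis .
  qed
  ultimately show "(\<forall>v. v \<notin> V \<longrightarrow> T v = 0) \<and>
    (\<forall>v\<in>V. T v = (\<Sum>i<n. ip v (e i) *\<^sub>C T (e i))) \<and>
    (\<forall>j<n. \<delta>P (T (e j)) = (\<Sum>i<n. T (e i) \<otimes> u i j))"
    using Mor_zero_off[OF T] by blast
next
  assume "(\<forall>v. v \<notin> V \<longrightarrow> T v = 0) \<and>
    (\<forall>v\<in>V. T v = (\<Sum>i<n. ip v (e i) *\<^sub>C T (e i))) \<and>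
    (\<forall>j<n. \<delta>P (T (e j)) = (\<Sum>i<n. T (e i) \<otimes> u i j))"
  then have off: "\<forall>v. v \<notin> V \<longrightarrow> T v = 0"
    and T: "\<And>v. v \<in> V \<Longrightarrow> T v = (\<Sum>i<n. ip v (e i) *\<^sub>C T (e i))"
    and \<delta>T: "\<And>j. j < n \<Longrightarrow> \<delta>P (T (e j)) = (\<Sum>i<n. T (e i) \<otimes> u i j)"
    by blast+
  have "(\<Sum>i<n. ip (x + y) (e i) *\<^sub>C T (e i)) =
      (\<Sum>i<n. ip x (e i) *\<^sub>C T (e i)) + (\<Sum>i<n. ip y (e i) *\<^sub>C T (e i))" if "x \<in> V" "y \<in> V" for x y
    using that orthonormal_basis_in[OF e] by (simp add: ip_add scaleC_add_left sum.distrib)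
  moreover have "(\<Sum>i<n. ip (c *\<^sub>C x) (e i) *\<^sub>C T (e i)) = c *\<^sub>C (\<Sum>i<n. ip x (e i) *\<^sub>C T (e i))"
    if "x \<in> V" for c x
    using that orthonormal_basis_in[OF e]
    by (simp add: ip_scale complex_vector.scale_sum_right scaleC_scaleC)
  ultimately obtain T' where T': "complex_linear T'"
    "\<And>v. v \<in> V \<Longrightarrow> T' v = (\<Sum>i<n. ip v (e i) *\<^sub>C T (e i))"
    using complex_linear_extension[OF subspace, of "\<lambda>v. \<Sum>i<n. ip v (e i) *\<^sub>C T (e i)"] by blast
  have T'T: "T' v = T v" if "v \<in> V" for v
    unfolding T'(2)[OF that] by (rule T[OF that, symmetric])
  note T'_id = tensor_map[OF T'(1) complex_linear_id(1)]
  have basis: "tensor_map T' id (\<delta> (e j)) = \<delta>P (T (e j))" if "j < n" for j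
    using orthonormal_basis_in[OF e]
    by (simp add: u[OF that] \<delta>T[OF that] complex_linear_sum[OF T'_id(1)] T'_id(2) T'T)
  have "tensor_map T' id (\<delta> v) = \<delta>P (T v)" if v: "v \<in> V" for v
  proof -
    have "tensor_map T' id (\<delta> v) = tensor_map T' id (\<delta> (\<Sum>i<n. ip v (e i) *\<^sub>C e i))"
      by (simp flip: orthonormal_basis_expand[OF e v])
    also have "\<dots> = (\<Sum>i<n. ip v (e i) *\<^sub>C tensor_map T' id (\<delta> (e i)))"
      by (simp only: complex_linear_sum[OF \<delta>] complex_linear_sum[OF T'_id(1)]
          complex_linearD(2)[OF \<delta>] complex_linearD(2)[OF T'_id(1)])
    also have "\<dots> = (\<Sum>i<n. ip v (e i) *\<^sub>C \<delta>P (T (e i)))"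
      by (intro sum.cong refl) (simp only: basis lessThan_iff)
    also have "\<dots> = \<delta>P (\<Sum>i<n. ip v (e i) *\<^sub>C T (e i))"
      by (simp only: complex_linear_sum[OF \<delta>P] complex_linearD(2)[OF \<delta>P])
    finally show ?thesis by (simp flip: T[OF v])
  qed
  then show "T \<in> Mor V \<delta> UNIV \<delta>P"
    using off T'(1) T'T unfolding Mor_def by blast
qed

locale associated_vector_bundle =
  quantum_principal_bundle \<Delta> \<epsilon> \<Delta>P B + inner_product_subspace V ip
  for \<Delta> :: "'h::complex_star_algebra \<Rightarrow> ('h, 'h) tensor"
    and \<epsilon> :: "'h \<Rightarrow> complex"
    and \<Delta>P :: "'p::complex_star_algebra \<Rightarrow> ('p, 'h) tensor"
    and B :: "'p set"
    and V :: "'v::complex_vector set"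
    and ip :: "'v \<Rightarrow> 'v \<Rightarrow> complex" +
  fixes \<delta> :: "'v \<Rightarrow> ('v, 'h) tensor"
    and n :: nat
    and e :: "nat \<Rightarrow> 'v"
    and u :: "nat \<Rightarrow> nat \<Rightarrow> 'h"
    and d :: nat
    and T :: "nat \<Rightarrow> 'v \<Rightarrow> 'p"
  assumes basis: "orthonormal_basis V ip n e"
    and corep_linear: "complex_linear \<delta>"
    and matrix: "j < n \<Longrightarrow> \<delta> (e j) = (\<Sum>i<n. e i \<otimes> u i j)"
    and coisometry: "i < n \<Longrightarrow> j < n \<Longrightarrow> (\<Sum>k<n. u i k * star (u j k)) = (if i = j then 1 else 0)"
    and morphism_frame: "morphism_frame V ip \<delta> \<Delta>P d T"
begin

lemma coaction_linear: "complex_linear \<Delta>P"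
  using coaction_star_hom by (intro complex_linearI) (auto simp: star_hom_on_def)

lemma coaction_mult: "\<Delta>P (x * y) = \<Delta>P x * \<Delta>P y" and coaction_star: "\<Delta>P (star x) = star (\<Delta>P x)"
  using coaction_star_hom by (auto simp: star_hom_on_def)

abbreviation sections :: "('v \<Rightarrow> 'p) set"
  where "sections \<equiv> associated_left_bundle \<Delta>P V \<delta>"

abbreviation hermitian :: "('v \<Rightarrow> 'p) \<Rightarrow> ('v \<Rightarrow> 'p) \<Rightarrow> 'p"
  where "hermitian \<equiv> canonical_hermitian n e"

lemma sections_iff: "x \<in> sections \<longleftrightarrow> (\<forall>v. v \<notin> V \<longrightarrow> x v = 0) \<and>
    (\<forall>v\<in>V. x v = (\<Sum>i<n. ip v (e i) *\<^sub>C x (e i))) \<and>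
    (\<forall>j<n. \<Delta>P (x (e j)) = (\<Sum>i<n. x (e i) \<otimes> u i j))"
  unfolding associated_left_bundle_def
  by (rule Mor_iff_matrix[OF basis corep_linear coaction_linear matrix])

lemma sections_off: "x \<in> sections \<Longrightarrow> v \<notin> V \<Longrightarrow> x v = 0"
  and sections_expand: "x \<in> sections \<Longrightarrow> v \<in> V \<Longrightarrow> x v = (\<Sum>i<n. ip v (e i) *\<^sub>C x (e i))"
  and sections_coaction: "x \<in> sections \<Longrightarrow> j < n \<Longrightarrow> \<Delta>P (x (e j)) = (\<Sum>i<n. x (e i) \<otimes> u i j)"
  unfolding sections_iff by blast+

lemma csubspace_sections: "csubspace sections"
  unfolding complex_vector.subspace_def
proof (intro conjI ballI allI)
  show "0 \<in> sections"
    by (simp add: sections_iff complex_vector.linear_0[OF coaction_linear])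
  fix x y c assume x: "x \<in> sections" and y: "y \<in> sections"
  show "x + y \<in> sections"
    unfolding sections_iff
  proof (intro conjI ballI allI impI)
    fix v assume "v \<in> V"
    show "(x + y) v = (\<Sum>i<n. ip v (e i) *\<^sub>C (x + y) (e i))"
      using sections_expand[OF x \<open>v \<in> V\<close>] sections_expand[OF y \<open>v \<in> V\<close>]
      by (simp add: scaleC_add_right sum.distrib)
  qed (simp_all add: sections_off[OF x] sections_off[OF y] complex_linearD(1)[OF coaction_linear]
      sections_coaction[OF x] sections_coaction[OF y] tensor_add_left sum.distrib)
  show "c *\<^sub>C x \<in> sections"
    unfolding sections_iff
  proof (intro conjI ballI allI impI)
    fix v assume "v \<in> V"
    show "(c *\<^sub>C x) v = (\<Sum>i<n. ip v (e i) *\<^sub>C (c *\<^sub>C x) (e i))"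
      using sections_expand[OF x \<open>v \<in> V\<close>]
      by (simp add: complex_vector.scale_sum_right scaleC_scaleC mult.commute)
  qed (simp_all add: sections_off[OF x] complex_linearD(2)[OF coaction_linear]
      sections_coaction[OF x] tensor_scaleC_left complex_vector.scale_sum_right)
qed

lemma left_action_sections:
  assumes b: "b \<in> B" and x: "x \<in> sections"
  shows "left_action b x \<in> sections"
  unfolding sections_iff
proof (intro conjI ballI allI impI)
  fix v assume "v \<in> V"
  show "left_action b x v = (\<Sum>i<n. ip v (e i) *\<^sub>C left_action b x (e i))"
    using sections_expand[OF x \<open>v \<in> V\<close>]
    by (simp add: left_action_def sum_distrib_left mult_scaleC_right)
next
  fix j assume "j < n"
  then show "\<Delta>P (left_action b x (e j)) = (\<Sum>i<n. left_action b x (e i) \<otimes> u i j)"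
    using base_iff[of b] b
    by (simp add: left_action_def coaction_mult sections_coaction[OF x] sum_distrib_left tensor_mult)
qed (simp add: left_action_def sections_off[OF x])

text \<open>The coaction produces the entries of u times its adjoint in the second factor. By
  \<open>coisometry\<close> only the diagonal survives, so the element is coinvariant and lies in
  \<open>B\<close>.\<close>

lemma hermitian_base:
  assumes x: "x \<in> sections" and y: "y \<in> sections"
  shows "hermitian x y \<in> B"
proof -
  have "\<Delta>P (hermitian x y) = (\<Sum>k<n. \<Delta>P (x (e k)) * star (\<Delta>P (y (e k))))"
    by (simp add: canonical_hermitian_def complex_linear_sum[OF coaction_linear] coaction_mult coaction_star)
  also have "\<dots> = (\<Sum>k<n. \<Sum>i<n. \<Sum>j<n. (x (e i) * star (y (e j))) \<otimes> (u i k * star (u j k)))"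
    by (intro sum.cong refl)
      (simp add: sections_coaction[OF x] sections_coaction[OF y] star_sum star_tensor sum_product tensor_mult)
  also have "\<dots> = (\<Sum>i<n. \<Sum>j<n. (x (e i) * star (y (e j))) \<otimes> (\<Sum>k<n. u i k * star (u j k)))"
    unfolding tensor_sum_right
    by (rule trans[OF sum.swap], rule sum.cong[OF refl], rule sum.swap)
  also have "\<dots> = (\<Sum>i<n. \<Sum>j<n. if i = j then (x (e i) * star (y (e j))) \<otimes> 1 else 0)"
    by (intro sum.cong refl) (simp add: coisometry)
  also have "\<dots> = hermitian x y \<otimes> 1"
    by (simp add: canonical_hermitian_def tensor_sum_left)
  finally show ?thesis by (simp add: base_iff)
qed

lemma frame_in_sections: "k < d \<Longrightarrow> T k \<in> sections"
  using morphism_frame by (simp add: morphism_frame_def associated_left_bundle_def)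

text \<open>Reassociation moves \<open>star (T k (e i))\<close> from the coefficient next to
  \<open>T k v\<close>. The frame identity then collapses the sum over \<open>k\<close>, leaving the
  expansion of \<open>x v\<close> in the basis; hence the normalisation with the adjoint on the
  left.\<close>

lemma sections_reconstruction:
  assumes x: "x \<in> sections"
  shows "x = (\<Sum>k<d. left_action (hermitian x (T k)) (T k))"
proof
  fix v
  show "x v = (\<Sum>k<d. left_action (hermitian x (T k)) (T k)) v"
  proof (cases "v \<in> V")
    case True
    have "(\<Sum>k<d. left_action (hermitian x (T k)) (T k)) v =
        (\<Sum>k<d. \<Sum>i<n. x (e i) * (star (T k (e i)) * T k v))"
      by (simp add: sum_fun_apply left_action_def canonical_hermitian_def sum_distrib_right mult.assoc)
    also have "\<dots> = (\<Sum>i<n. x (e i) * (\<Sum>k<d. star (T k (e i)) * T k v))"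
      unfolding sum_distrib_left by (rule sum.swap)
    also have "\<dots> = (\<Sum>i<n. x (e i) * (ip v (e i) *\<^sub>C 1))"
      using morphism_frame orthonormal_basis_in[OF basis] True
      by (intro sum.cong refl) (simp add: morphism_frame_def)
    also have "\<dots> = x v"
      by (simp add: mult_scaleC_right flip: sections_expand[OF x True])
    finally show ?thesis by simp
  next
    case False
    then show ?thesis
      by (simp add: sum_fun_apply left_action_def sections_off[OF x] sections_off[OF frame_in_sections])
  qed
qed

lemma framed_module:
  assumes "cstar_completion B \<iota>"
  shows "framed_module B \<iota> left_action sections hermitian d T"
proof
  show "left_action (c *\<^sub>C 1) x = c *\<^sub>C x" for c and x :: "'v \<Rightarrow> 'p"
    by (simp add: left_action_def fun_eq_iff mult_scaleC_left)
  show "hermitian y x = star (hermitian x y)" for x y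
    by (simp add: canonical_hermitian_def star_sum star_mult star_star)
qed (use assms base_star_subalgebra csubspace_sections left_action_sections hermitian_base frame_in_sections
    sections_reconstruction in
    \<open>simp_all add: left_action_def canonical_hermitian_def fun_eq_iff algebra_simps sum.distrib
      sum_distrib_left\<close>)

end

text \<open>Completing \<open>B\<close> changes the scalars. The bundle therefore carries the inner
  product over \<open>B\<close>, with positivity tested in the completion, while completeness
  belongs to its extension of scalars, or to the bundle itself once \<open>B\<close> is
  complete.\<close>

theorem theorem3p12:
  fixes \<Delta> :: "'h::complex_star_algebra \<Rightarrow> ('h, 'h) tensor"
    and \<epsilon> :: "'h \<Rightarrow> complex"
    and S :: "'h \<Rightarrow> 'h"
    and \<gamma> :: "'h \<Rightarrow> 'g::cstar_algebra"
    and N :: nat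
    and u :: "nat \<Rightarrow> nat \<Rightarrow> 'h"
    and \<Delta>P :: "'p::complex_star_algebra \<Rightarrow> ('p, 'h) tensor"
    and B :: "'p set"
    and \<iota> :: "'p \<Rightarrow> 'a::cstar_algebra"
    and V :: "'v::complex_vector set"
    and ip :: "'v \<Rightarrow> 'v \<Rightarrow> complex"
    and \<delta> :: "'v \<Rightarrow> ('v, 'h) tensor"
    and n :: nat
    and e :: "nat \<Rightarrow> 'v"
  assumes "compact_matrix_quantum_group \<Delta> \<epsilon> S \<gamma> N u"
    and "quantum_principal_bundle \<Delta> \<epsilon> \<Delta>P B"
    and "cstar_completion B \<iota>"
    and frames: "\<And>(W :: 'v set) ipW \<delta>W m f.
      unitary_corepresentation \<Delta> \<epsilon> W ipW \<delta>W \<Longrightarrow> irreducible_corepresentation W \<delta>W \<Longrightarrow>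
      orthonormal_basis W ipW m f \<Longrightarrow>
      \<exists>d T. (\<forall>k<d. T k \<in> Mor W \<delta>W UNIV \<Delta>P) \<and>
        (\<forall>i<m. \<forall>j<m. (\<Sum>k<(d::nat). star (T k (f i)) * T k (f j)) = (if i = j then 1 else 0))"
    and "unitary_corepresentation \<Delta> \<epsilon> V ip \<delta>"
    and "orthonormal_basis V ip n e"
  shows "left_inner_product_module B \<iota> left_action
      (associated_left_bundle \<Delta>P V \<delta>) (canonical_hermitian n e) \<and>
    (\<exists>(F :: (nat \<Rightarrow> 'a) set) actF ipF j.
      left_hilbert_module UNIV id actF F ipF \<and>
      completes_module B \<iota> left_action
        (associated_left_bundle \<Delta>P V \<delta>) (canonical_hermitian n e) actF F ipF j) \<and>
    (\<iota> ` B = UNIV \<longrightarrow> left_hilbert_module B \<iota> left_action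
      (associated_left_bundle \<Delta>P V \<delta>) (canonical_hermitian n e))"
proof -
  interpret G: compact_matrix_quantum_group \<Delta> \<epsilon> S \<gamma> N u by fact
  interpret P: quantum_principal_bundle \<Delta> \<epsilon> \<Delta>P B by fact
  interpret V: unitary_hopf_corepresentation \<Delta> \<epsilon> S V ip \<delta>
    by (rule G.unitary_hopf_corepresentationI) fact
  have "\<exists>d T. morphism_frame W ip \<delta> \<Delta>P d T"
    if W: "unitary_corepresentation \<Delta> \<epsilon> W ip \<delta>" "irreducible_corepresentation W \<delta>" for W
  proof -
    interpret W: unitary_hopf_corepresentation \<Delta> \<epsilon> S W ip \<delta>
      by (rule G.unitary_hopf_corepresentationI[OF W(1)])
    obtain m f where f: "orthonormal_basis W ip m f"
      using W.finite_span W.exists_orthonormal_basis by blast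
    from frames[OF W f] obtain d :: nat and T where "\<forall>k<d. T k \<in> Mor W \<delta> UNIV \<Delta>P"
      "\<forall>i<m. \<forall>j<m. (\<Sum>k<d. star (T k (f i)) * T k (f j)) = (if i = j then 1 else 0)"
      by blast
    then have "morphism_frame W ip \<delta> \<Delta>P d T" by (intro W.morphism_frameI[OF f]) simp_all
    then show ?thesis by blast
  qed
  from G.exists_morphism_frame[OF this assms(5)]
  obtain d T where T: "morphism_frame V ip \<delta> \<Delta>P d T" by blast
  \<comment> \<open>The frame was found without reference to \<open>e\<close>; the matrix of
    \<delta> is now taken in the given basis, in which the Hermitian structure is written.\<close>
  obtain w where w: "\<And>j. j < n \<Longrightarrow> \<delta> (e j) = (\<Sum>i<n. e i \<otimes> w i j)"
    "\<And>i j. i < n \<Longrightarrow> j < n \<Longrightarrow> (\<Sum>k<n. w i k * star (w j k)) = (if i = j then 1 else 0)"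
    by (rule V.unitary_matrix[OF assms(6)]) (rule that; assumption)
  interpret associated_vector_bundle \<Delta> \<epsilon> \<Delta>P B V ip \<delta> n e w d T
    by (intro associated_vector_bundle.intro associated_vector_bundle_axioms.intro
        P.quantum_principal_bundle_axioms V.inner_product_subspace_axioms
        assms(6) V.coaction_linear w T)
  interpret framed_module B \<iota> left_action "associated_left_bundle \<Delta>P V \<delta>" "canonical_hermitian n e" d T
    by (rule framed_module) fact
  show ?thesis
    by (intro conjI exI[of _ gram_range] exI[of _ coord_act] exI[of _ coord_ip] exI[of _ coords] impI
        left_inner_product_module left_hilbert_module_gram_range completes_module_coords
        left_hilbert_module)
qed

end
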